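(* Let $X$ be a normal topometric space. Then for all Lipschitz constants $c < c'$, every continuous $c$-Lipschitz function $f\colon Y \to [0,1]$ defined on a closed subset $Y \subseteq X$ (with the induced topology and metric) extends to a continuous $c'$-Lipschitz function $g\colon X \to [0,1]$. Moreover, for an arbitrary topometric space $X$ the following are equivalent: (i) $X$ is a normal topometric space. (ii) For all Lipschitz constants $c<c'$, every continuous $c$-Lipschitz function $f\colon Y\to[0,1]$ on a closed subset $Y\subseteq X$ extends to a continuous $c'$-Lipschitz function $g\colon X\to[0,1]$. (iii) For every $c>0$, every finite $c$-Lipschitz approximation $\{(F_\alpha,G_\alpha):\alpha\in S\}$ on $X$ ($S\subseteq\mathbb R$ finite) is an approximation of some continuous $c$-Lipschitz function $h\colon X\to\mathbb R$. (iv) For all closed sets $F,G\subseteq X$ and every $0<r<d(F,G)$ there exists a continuous $1$-Lipschitz function $h\colon X\to[0,r]$ equal to $0$ on $F$ and to $r$ on $G$.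
   Context: A topometric space is a triple $(X,\mathcal T,d)$ where $\mathcal T$ is a topology on $X$ and $d\colon X\times X\to[0,\infty]$ is a metric (possibly taking the value $\infty$) such that (1) $d$ is lower semi-continuous on $X\times X$ with respect to $\mathcal T\times\mathcal T$, and (2) every $\mathcal T$-open set is open in the metric topology of $d$. Unqualified topological terms refer to $\mathcal T$, metric terms to $d$. For $A,B\subseteq X$, $d(A,B)=\inf\{d(a,b):a\in A,b\in B\}$, $d(x,A)=\inf_{a\in A}d(x,a)$. Lipschitz constants are nonnegative reals; $f$ is $c$-Lipschitz if $|f(x)-f(y)|\le c\,d(x,y)$ for all $x,y$. A topometric space $X$ is normal if (a) any two closed $F,G\subseteq X$ with $d(F,G)>0$ can be separated by disjoint open sets, and (b) for every closed $F\subseteq X$ and $r>0$ the set $\overline B(F,r)=\{x: d(x,F)\le r\}$ is closed. Let $c>0$, $S\subseteq\mathbb R$, and let $\{(F_\alpha,G_\alpha):\alpha\in S\}$ be a family of pairs of closed subsets of $X$. It is a partial $c$-Lipschitz approximation if $c\cdot d(F_\alpha,G_\beta)>\beta-\alpha$ whenever $\alpha<\beta$ are in $S$; it is a (total) $c$-Lipschitz approximation if moreover $F_\alpha\cup G_\alpha=X$ for all $\alpha\in S$. It is an approximation of a function $h\colon X\to\mathbb R$ if $h\le\alpha$ on $F_\alpha$ and $h\ge\alpha$ on $G_\alpha$ for all $\alpha\in S$. *)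

theory Defs
  imports "HOL-Analysis.Analysis"
begin

definition ext_metric_on :: "'a set \<Rightarrow> ('a \<Rightarrow> 'a \<Rightarrow> ennreal) \<Rightarrow> bool" where
  "ext_metric_on M d \<longleftrightarrow>
     (\<forall>x\<in>M. \<forall>y\<in>M. d x y = 0 \<longleftrightarrow> x = y) \<and>
     (\<forall>x\<in>M. \<forall>y\<in>M. d x y = d y x) \<and>
     (\<forall>x\<in>M. \<forall>y\<in>M. \<forall>z\<in>M. d x z \<le> d x y + d y z)"

definition ext_metric_open :: "'a set \<Rightarrow> ('a \<Rightarrow> 'a \<Rightarrow> ennreal) \<Rightarrow> 'a set \<Rightarrow> bool" where
  "ext_metric_open M d U \<longleftrightarrow>
     U \<subseteq> M \<and> (\<forall>x\<in>U. \<exists>e>0. \<forall>y\<in>M. d x y < e \<longrightarrow> y \<in> U)"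

definition lower_semicontinuous_map :: "'a topology \<Rightarrow> ('a \<Rightarrow> 'b::linorder) \<Rightarrow> bool" where
  "lower_semicontinuous_map X f \<longleftrightarrow> (\<forall>a. openin X {x \<in> topspace X. a < f x})"

text \<open>The underlying set is the carrier of the topology; values of the distance function
  outside it are irrelevant.\<close>

definition topometric_space :: "'a topology \<Rightarrow> ('a \<Rightarrow> 'a \<Rightarrow> ennreal) \<Rightarrow> bool" where
  "topometric_space T d \<longleftrightarrow>
     ext_metric_on (topspace T) d \<and>
     lower_semicontinuous_map (prod_topology T T) (\<lambda>(x, y). d x y) \<and>
     (\<forall>U. openin T U \<longrightarrow> ext_metric_open (topspace T) d U)"

text \<open>Infima are taken in \<^typ>\<open>ennreal\<close>, so the distance to the empty set is infinite.\<close>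

definition pt_dist :: "('a \<Rightarrow> 'a \<Rightarrow> ennreal) \<Rightarrow> 'a \<Rightarrow> 'a set \<Rightarrow> ennreal" where
  "pt_dist d x A = (INF a\<in>A. d x a)"

definition set_dist :: "('a \<Rightarrow> 'a \<Rightarrow> ennreal) \<Rightarrow> 'a set \<Rightarrow> 'a set \<Rightarrow> ennreal" where
  "set_dist d A B = (INF (a, b)\<in>A \<times> B. d a b)"

definition normal_topometric_space :: "'a topology \<Rightarrow> ('a \<Rightarrow> 'a \<Rightarrow> ennreal) \<Rightarrow> bool" where
  "normal_topometric_space T d \<longleftrightarrow>
     topometric_space T d \<and>
     (\<forall>F G. closedin T F \<and> closedin T G \<and> set_dist d F G > 0 \<longrightarrow>
        (\<exists>U V. openin T U \<and> openin T V \<and> F \<subseteq> U \<and> G \<subseteq> V \<and> disjnt U V)) \<and>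
     (\<forall>F. \<forall>r::real. closedin T F \<and> r > 0 \<longrightarrow>
        closedin T {x \<in> topspace T. pt_dist d x F \<le> ennreal r})"

text \<open>Meant for nonnegative \<open>c\<close>, since \<^const>\<open>ennreal\<close> truncates negative reals to 0.
  The product is that of \<^typ>\<open>ennreal\<close>, where 0 times infinity is 0, so the 0-Lipschitz
  functions are exactly the constant ones.\<close>

definition lipschitz_fun_on ::
    "real \<Rightarrow> ('a \<Rightarrow> 'a \<Rightarrow> ennreal) \<Rightarrow> 'a set \<Rightarrow> ('a \<Rightarrow> real) \<Rightarrow> bool" where
  "lipschitz_fun_on c d A f \<longleftrightarrow>
     (\<forall>x\<in>A. \<forall>y\<in>A. ennreal \<bar>f x - f y\<bar> \<le> ennreal c * d x y)"

definition partial_lipschitz_approximation ::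
    "'a topology \<Rightarrow> ('a \<Rightarrow> 'a \<Rightarrow> ennreal) \<Rightarrow> real \<Rightarrow> real set
      \<Rightarrow> (real \<Rightarrow> 'a set) \<Rightarrow> (real \<Rightarrow> 'a set) \<Rightarrow> bool" where
  "partial_lipschitz_approximation T d c S F G \<longleftrightarrow>
     (\<forall>\<alpha>\<in>S. closedin T (F \<alpha>) \<and> closedin T (G \<alpha>)) \<and>
     (\<forall>\<alpha>\<in>S. \<forall>\<beta>\<in>S. \<alpha> < \<beta> \<longrightarrow>
        ennreal c * set_dist d (F \<alpha>) (G \<beta>) > ennreal (\<beta> - \<alpha>))"

definition lipschitz_approximation ::
    "'a topology \<Rightarrow> ('a \<Rightarrow> 'a \<Rightarrow> ennreal) \<Rightarrow> real \<Rightarrow> real set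
      \<Rightarrow> (real \<Rightarrow> 'a set) \<Rightarrow> (real \<Rightarrow> 'a set) \<Rightarrow> bool" where
  "lipschitz_approximation T d c S F G \<longleftrightarrow>
     partial_lipschitz_approximation T d c S F G \<and>
     (\<forall>\<alpha>\<in>S. F \<alpha> \<union> G \<alpha> = topspace T)"

definition approximates ::
    "real set \<Rightarrow> (real \<Rightarrow> 'a set) \<Rightarrow> (real \<Rightarrow> 'a set) \<Rightarrow> ('a \<Rightarrow> real) \<Rightarrow> bool" where
  "approximates S F G h \<longleftrightarrow>
     (\<forall>\<alpha>\<in>S. (\<forall>x\<in>F \<alpha>. h x \<le> \<alpha>) \<and> (\<forall>x\<in>G \<alpha>. h x \<ge> \<alpha>))"

end

theory Submission
  imports Defs
begin

text \<open>In a normal space, a partial Lipschitz approximation \<open>F\<close>, \<open>G\<close> with finitely many nonempty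
  members can be made total at any level \<open>\<alpha>\<close>: the finite union of the closed balls about the
  \<open>F \<beta>\<close> (\<open>\<beta> < \<alpha>\<close>) of radius slightly above \<open>(\<alpha> - \<beta>) / c\<close> and the corresponding union for the
  \<open>G \<gamma>\<close> (\<open>\<gamma> > \<alpha>\<close>) are closed and at positive distance, so disjoint open sets \<open>U\<close>, \<open>V\<close> separate
  them, and the complements of \<open>V\<close> and \<open>U\<close> can be added to \<open>F \<alpha>\<close> and \<open>G \<alpha>\<close>. Doing this for a
  countable dense set of levels gives, as in Urysohn's lemma, a continuous Lipschitz function:
  the infimum of the levels \<open>\<alpha>\<close> with \<open>x \<in> F \<alpha>\<close>.

  For the extension of \<open>f\<close>, finiteness of the approximation only allows a function \<open>g\<close> that is
  close to \<open>f\<close> on \<open>Y\<close>. The error is halved repeatedly, at the price of slightly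
  increasing the Lipschitz constant each time, and the new function is kept close to the old
  one by putting the sublevel sets of \<open>g\<close>, shifted by the current error, into the approximation.
  The uniform limit extends \<open>f\<close>.\<close>

section \<open>Extended distances, Lipschitz constants and margins\<close>

lemma ennreal_le_mult_iff:
  assumes "c > 0" "t \<ge> 0"
  shows "ennreal t \<le> ennreal c * D \<longleftrightarrow> ennreal (t / c) \<le> D"
proof (cases D)
  case (real u)
  then show ?thesis
    using assms by (simp add: ennreal_mult[symmetric] field_simps)
next
  case top
  then show ?thesis
    using assms by (simp add: ennreal_mult_top)
qed

lemma ennreal_less_mult_iff:
  assumes "c > 0" "t \<ge> 0"
  shows "ennreal t < ennreal c * D \<longleftrightarrow> ennreal (t / c) < D"
proof (cases D)
  case (real u)
  then show ?thesis
    using assms by (simp add: ennreal_mult[symmetric] ennreal_less_iff field_simps)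
next
  case top
  then show ?thesis
    using assms by (simp add: ennreal_mult_top)
qed

lemma lipschitz_fun_on_iff:
  assumes "c > 0"
  shows "lipschitz_fun_on c d A f \<longleftrightarrow> (\<forall>x\<in>A. \<forall>y\<in>A. ennreal (\<bar>f x - f y\<bar> / c) \<le> d x y)"
  unfolding lipschitz_fun_on_def using assms by (simp add: ennreal_le_mult_iff)

lemma lipschitz_fun_on_mono:
  assumes "lipschitz_fun_on c d A f" "c \<le> c'"
  shows "lipschitz_fun_on c' d A f"
  unfolding lipschitz_fun_on_def
proof (intro ballI)
  fix x y assume "x \<in> A" "y \<in> A"
  then have "ennreal \<bar>f x - f y\<bar> \<le> ennreal c * d x y"
    using assms(1) by (auto simp: lipschitz_fun_on_def)
  also have "\<dots> \<le> ennreal c' * d x y"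
    using assms(2) by (intro mult_right_mono ennreal_leI) auto
  finally show "ennreal \<bar>f x - f y\<bar> \<le> ennreal c' * d x y" .
qed

lemma ext_metric_on_commute:
  assumes "ext_metric_on M d" "x \<in> M" "y \<in> M"
  shows "d x y = d y x"
  using assms by (simp add: ext_metric_on_def)

text \<open>Trades a strict inequality for a possibly infinite, unattained infimum for a pointwise
  bound with a real margin. Any value strictly between \<open>s\<close> and the infimum is finite
  and provides \<open>s'\<close>; if one of the sets is empty, every \<open>s'\<close>
  works.\<close>

lemma less_set_dist_iff:
  assumes "s \<ge> 0"
  shows "ennreal s < set_dist d A B \<longleftrightarrow> (\<exists>s'>s. \<forall>a\<in>A. \<forall>b\<in>B. ennreal s' \<le> d a b)"
proof
  assume "ennreal s < set_dist d A B"
  then obtain u where u: "ennreal s < u" "u < set_dist d A B"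
    using dense by blast
  then have "u < top"
    by (meson less_le_trans top_greatest)
  then obtain s' where s': "u = ennreal s'" "s' \<ge> 0"
    by (cases u) auto
  have "ennreal s' \<le> d a b" if "a \<in> A" "b \<in> B" for a b
  proof -
    have "set_dist d A B \<le> d a b"
      unfolding set_dist_def using that by (auto intro!: INF_lower2[of "(a, b)"])
    then show ?thesis
      using u s' by auto
  qed
  then show "\<exists>s'>s. \<forall>a\<in>A. \<forall>b\<in>B. ennreal s' \<le> d a b"
    using u s' assms by (auto simp: ennreal_less_iff)
next
  assume "\<exists>s'>s. \<forall>a\<in>A. \<forall>b\<in>B. ennreal s' \<le> d a b"
  then obtain s' where s': "s' > s" "\<forall>a\<in>A. \<forall>b\<in>B. ennreal s' \<le> d a b"
    by blast
  have "ennreal s' \<le> set_dist d A B"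
    unfolding set_dist_def using s' by (auto intro!: INF_greatest)
  moreover have "ennreal s < ennreal s'"
    using s'(1) assms by (simp add: ennreal_less_iff)
  ultimately show "ennreal s < set_dist d A B"
    by (rule less_le_trans[rotated])
qed

lemma pt_dist_lessE:
  assumes "pt_dist d x A < e"
  obtains a where "a \<in> A" "d x a < e"
  using assms unfolding pt_dist_def by (auto simp: INF_less_iff)

text \<open>The working form of the definition: pointwise bounds pass to smaller sets at once and
  are vacuous for empty members.\<close>

lemma partial_lipschitz_approximation_iff:
  assumes "c > 0"
  shows "partial_lipschitz_approximation T d c S F G \<longleftrightarrow>
     (\<forall>\<alpha>\<in>S. closedin T (F \<alpha>) \<and> closedin T (G \<alpha>)) \<and>
     (\<forall>\<alpha>\<in>S. \<forall>\<beta>\<in>S. \<alpha> < \<beta> \<longrightarrow>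
        (\<exists>s > (\<beta> - \<alpha>) / c. \<forall>a\<in>F \<alpha>. \<forall>b\<in>G \<beta>. ennreal s \<le> d a b))"
proof -
  have "ennreal (\<beta> - \<alpha>) < ennreal c * set_dist d (F \<alpha>) (G \<beta>) \<longleftrightarrow>
      (\<exists>s > (\<beta> - \<alpha>) / c. \<forall>a\<in>F \<alpha>. \<forall>b\<in>G \<beta>. ennreal s \<le> d a b)" if "\<alpha> < \<beta>" for \<alpha> \<beta>
    using that assms by (subst ennreal_less_mult_iff) (auto simp: less_set_dist_iff)
  then show ?thesis
    unfolding partial_lipschitz_approximation_def by blast
qed

text \<open>Each pair of levels has its own margin; with finitely many pairs, one margin serves all.
  The filter \<open>at_right 0\<close> stands in for a minimum of the margins, so the case without
  any pair is not special.\<close>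

lemma partial_lipschitz_approximation_gap:
  assumes "c > 0" "finite S" "partial_lipschitz_approximation T d c S F G"
  obtains \<delta> where "\<delta> > 0"
    "\<And>\<alpha> \<beta> a b. \<lbrakk>\<alpha> \<in> S; \<beta> \<in> S; \<alpha> < \<beta>; a \<in> F \<alpha>; b \<in> G \<beta>\<rbrakk>
        \<Longrightarrow> ennreal ((\<beta> - \<alpha>) / c + \<delta>) \<le> d a b"
proof -
  have "eventually (\<lambda>\<delta>. \<alpha> < \<beta> \<longrightarrow> (\<forall>a\<in>F \<alpha>. \<forall>b\<in>G \<beta>. ennreal ((\<beta> - \<alpha>) / c + \<delta>) \<le> d a b)) (at_right 0)"
    if \<alpha>\<beta>: "\<alpha> \<in> S" "\<beta> \<in> S" for \<alpha> \<beta>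
  proof (cases "\<alpha> < \<beta>")
    case True
    then obtain s where s: "s > (\<beta> - \<alpha>) / c" "\<forall>a\<in>F \<alpha>. \<forall>b\<in>G \<beta>. ennreal s \<le> d a b"
      using assms(3) \<alpha>\<beta> unfolding partial_lipschitz_approximation_iff[OF assms(1)] by blast
    have "eventually (\<lambda>\<delta>. \<delta> < s - (\<beta> - \<alpha>) / c) (at_right 0)"
      unfolding eventually_at_right_field using s(1) by (intro exI[of _ "s - (\<beta> - \<alpha>) / c"]) auto
    then show ?thesis
    proof eventually_elim
      case (elim \<delta>)
      then have "ennreal ((\<beta> - \<alpha>) / c + \<delta>) \<le> ennreal s"
        by (intro ennreal_leI) auto
      then show ?case
        using s(2) order_trans by blast
    qed
  qed auto
  then have "eventually (\<lambda>\<delta>. \<forall>p\<in>S \<times> S. fst p < snd p \<longrightarrow>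
      (\<forall>a\<in>F (fst p). \<forall>b\<in>G (snd p). ennreal ((snd p - fst p) / c + \<delta>) \<le> d a b)) (at_right 0)"
    using assms(2) by (intro eventually_ball_finite) auto
  moreover have "eventually (\<lambda>\<delta>. \<delta> > (0::real)) (at_right 0)"
    by (rule eventually_at_right_less)
  ultimately have "eventually (\<lambda>\<delta>. \<delta> > 0 \<and> (\<forall>p\<in>S \<times> S. fst p < snd p \<longrightarrow>
      (\<forall>a\<in>F (fst p). \<forall>b\<in>G (snd p). ennreal ((snd p - fst p) / c + \<delta>) \<le> d a b))) (at_right 0)"
    by eventually_elim auto
  from eventually_happens'[OF trivial_limit_at_right_real this]
  obtain \<delta> where "\<delta> > 0 \<and> (\<forall>p\<in>S \<times> S. fst p < snd p \<longrightarrow>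
      (\<forall>a\<in>F (fst p). \<forall>b\<in>G (snd p). ennreal ((snd p - fst p) / c + \<delta>) \<le> d a b))" ..
  then show thesis
    by (intro that[of \<delta>]) auto
qed

section \<open>Completing partial approximations in a normal space\<close>

text \<open>The slack \<open>\<delta>/4\<close> makes every radius positive, so the balls are closed
  even where \<open>r\<close> or \<open>s\<close> vanishes, and finite unions stay closed. The
  unions are at distance at least \<open>\<delta>/3\<close>: otherwise some points of
  \<open>F \<beta>\<close> and \<open>G \<gamma>\<close> would be closer than
  \<open>r \<beta> + s \<gamma> + \<delta>\<close>.\<close>

lemma normal_separate_balls:
  assumes normal: "normal_topometric_space T d" and "finite K" "finite L" "\<delta> > 0"
    and closed: "\<And>\<beta>. \<beta> \<in> K \<Longrightarrow> closedin T (F \<beta>)" "\<And>\<gamma>. \<gamma> \<in> L \<Longrightarrow> closedin T (G \<gamma>)"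
    and nonneg: "\<And>\<beta>. \<beta> \<in> K \<Longrightarrow> r \<beta> \<ge> 0" "\<And>\<gamma>. \<gamma> \<in> L \<Longrightarrow> s \<gamma> \<ge> 0"
    and far: "\<And>\<beta> \<gamma> a b. \<lbrakk>\<beta> \<in> K; \<gamma> \<in> L; a \<in> F \<beta>; b \<in> G \<gamma>\<rbrakk>
      \<Longrightarrow> ennreal (r \<beta> + s \<gamma> + \<delta>) \<le> d a b"
  obtains U V where "openin T U" "openin T V" "disjnt U V"
    "\<And>\<beta> x. \<lbrakk>\<beta> \<in> K; x \<in> topspace T; pt_dist d x (F \<beta>) \<le> ennreal (r \<beta> + \<delta>/4)\<rbrakk> \<Longrightarrow> x \<in> U"
    "\<And>\<gamma> x. \<lbrakk>\<gamma> \<in> L; x \<in> topspace T; pt_dist d x (G \<gamma>) \<le> ennreal (s \<gamma> + \<delta>/4)\<rbrakk> \<Longrightarrow> x \<in> V"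
proof -
  define A where "A = (\<Union>\<beta>\<in>K. {x \<in> topspace T. pt_dist d x (F \<beta>) \<le> ennreal (r \<beta> + \<delta>/4)})"
  define B where "B = (\<Union>\<gamma>\<in>L. {x \<in> topspace T. pt_dist d x (G \<gamma>) \<le> ennreal (s \<gamma> + \<delta>/4)})"
  have cl: "closedin T {x \<in> topspace T. pt_dist d x C \<le> ennreal u}" if "closedin T C" "u > 0" for C u
    using normal that unfolding normal_topometric_space_def by blast
  have ext: "ext_metric_on (topspace T) d"
    using normal by (auto simp: normal_topometric_space_def topometric_space_def)
  have "closedin T A"
  proof -
    have "closedin T {x \<in> topspace T. pt_dist d x (F \<beta>) \<le> ennreal (r \<beta> + \<delta>/4)}" if "\<beta> \<in> K" for \<beta>
      using closed(1) nonneg(1)[of \<beta>] \<open>\<delta> > 0\<close> that by (intro cl) auto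
    then show ?thesis
      unfolding A_def using assms(2) by (intro closedin_Union) auto
  qed
  moreover have "closedin T B"
  proof -
    have "closedin T {x \<in> topspace T. pt_dist d x (G \<gamma>) \<le> ennreal (s \<gamma> + \<delta>/4)}" if "\<gamma> \<in> L" for \<gamma>
      using closed(2) nonneg(2)[of \<gamma>] \<open>\<delta> > 0\<close> that by (intro cl) auto
    then show ?thesis
      unfolding B_def using assms(3) by (intro closedin_Union) auto
  qed
  moreover have "ennreal (\<delta>/3) \<le> d x y" if xy: "x \<in> A" "y \<in> B" for x y
  proof (rule ccontr)
    assume "\<not> ennreal (\<delta>/3) \<le> d x y"
    then have dxy: "d x y < ennreal (\<delta>/3)"
      by simp
    obtain \<beta> where \<beta>: "\<beta> \<in> K" "x \<in> topspace T" "pt_dist d x (F \<beta>) \<le> ennreal (r \<beta> + \<delta>/4)"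
      using xy(1) unfolding A_def by blast
    obtain \<gamma> where \<gamma>: "\<gamma> \<in> L" "y \<in> topspace T" "pt_dist d y (G \<gamma>) \<le> ennreal (s \<gamma> + \<delta>/4)"
      using xy(2) unfolding B_def by blast
    \<comment> \<open>The infimum \<open>pt_dist\<close> need not be attained; enlarging
      \<open>\<delta>/4\<close> to \<open>\<delta>/3\<close> yields an actual point of
      \<open>F \<beta>\<close>. Three such thirds add up to \<open>\<delta>\<close> below.\<close>
    have "pt_dist d x (F \<beta>) < ennreal (r \<beta> + \<delta>/3)"
      using \<beta>(3) nonneg(1)[OF \<beta>(1)] \<open>\<delta> > 0\<close> by (elim le_less_trans) (simp add: ennreal_less_iff)
    then obtain a where a: "a \<in> F \<beta>" "d x a < ennreal (r \<beta> + \<delta>/3)"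
      by (rule pt_dist_lessE)
    have "pt_dist d y (G \<gamma>) < ennreal (s \<gamma> + \<delta>/3)"
      using \<gamma>(3) nonneg(2)[OF \<gamma>(1)] \<open>\<delta> > 0\<close> by (elim le_less_trans) (simp add: ennreal_less_iff)
    then obtain b where b: "b \<in> G \<gamma>" "d y b < ennreal (s \<gamma> + \<delta>/3)"
      by (rule pt_dist_lessE)
    have ab: "a \<in> topspace T" "b \<in> topspace T"
      using a b \<beta> \<gamma> closed closedin_subset by blast+
    have "d a b \<le> d a x + d x b" "d x b \<le> d x y + d y b" "d a x = d x a"
      using ext ab \<beta>(2) \<gamma>(2) unfolding ext_metric_on_def by blast+
    then have "d a b \<le> d x a + (d x y + d y b)"
      by (metis add_left_mono order_trans)
    also have "\<dots> < ennreal (r \<beta> + \<delta>/3) + (ennreal (\<delta>/3) + ennreal (s \<gamma> + \<delta>/3))"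
      using a b dxy by (intro add_strict_mono) auto
    also have "\<dots> = ennreal (r \<beta> + s \<gamma> + \<delta>)"
      using nonneg(1)[OF \<beta>(1)] nonneg(2)[OF \<gamma>(1)] \<open>\<delta> > 0\<close> by (simp flip: ennreal_plus)
    finally show False
      using far[OF \<beta>(1) \<gamma>(1) a(1) b(1)] by simp
  qed
  then have "set_dist d A B > 0"
    using less_set_dist_iff[of 0 d A B] \<open>\<delta> > 0\<close>
    by (metis divide_pos_pos ennreal_0 order_refl zero_less_numeral)
  ultimately have "\<exists>U V. openin T U \<and> openin T V \<and> A \<subseteq> U \<and> B \<subseteq> V \<and> disjnt U V"
    using normal unfolding normal_topometric_space_def by simp
  then obtain U V where "openin T U" "openin T V" "A \<subseteq> U" "B \<subseteq> V" "disjnt U V"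
    by blast
  then show thesis
    by (intro that[of U V]) (auto simp: A_def B_def)
qed

text \<open>A finite approximation is encoded as one on all of \<open>\<real>\<close> with finitely many nonempty members;
  empty members are at infinite distance from everything and impose no condition.\<close>

lemma partial_lipschitz_approximation_complete_at:
  assumes normal: "normal_topometric_space T d" and "c > 0"
    and partial: "partial_lipschitz_approximation T d c UNIV F G"
    and fin: "finite {\<alpha>. F \<alpha> \<noteq> {} \<or> G \<alpha> \<noteq> {}}"
  obtains A B where "F \<alpha> \<subseteq> A" "G \<alpha> \<subseteq> B" "A \<union> B = topspace T"
    "partial_lipschitz_approximation T d c UNIV (F(\<alpha> := A)) (G(\<alpha> := B))"
proof -
  define S where "S = {\<alpha>. F \<alpha> \<noteq> {} \<or> G \<alpha> \<noteq> {}}"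
  have "finite S"
    using fin by (simp add: S_def)
  moreover have "partial_lipschitz_approximation T d c S F G"
    using partial unfolding partial_lipschitz_approximation_def by blast
  ultimately obtain \<delta> where "\<delta> > 0" and \<delta>:
    "\<And>\<alpha> \<beta> a b. \<lbrakk>\<alpha> \<in> S; \<beta> \<in> S; \<alpha> < \<beta>; a \<in> F \<alpha>; b \<in> G \<beta>\<rbrakk>
        \<Longrightarrow> ennreal ((\<beta> - \<alpha>) / c + \<delta>) \<le> d a b"
    using partial_lipschitz_approximation_gap[OF \<open>c > 0\<close>, of S T d F G] by metis
  define K where "K = {\<beta>\<in>S. \<beta> < \<alpha>}"
  define L where "L = {\<beta>\<in>S. \<beta> > \<alpha>}"
  have closed: "closedin T (F \<beta>)" "closedin T (G \<beta>)" for \<beta>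
    using partial unfolding partial_lipschitz_approximation_def by blast+
  \<comment> \<open>Splitting \<open>\<gamma> - \<beta>\<close> at \<open>\<alpha>\<close> turns the
    gap between two members into two radii plus the margin.\<close>
  have far: "ennreal ((\<alpha> - \<beta>) / c + (\<gamma> - \<alpha>) / c + \<delta>) \<le> d a b"
    if "\<beta> \<in> K" "\<gamma> \<in> L" "a \<in> F \<beta>" "b \<in> G \<gamma>" for \<beta> \<gamma> a b
    using \<delta>[of \<beta> \<gamma> a b] that by (simp add: K_def L_def flip: add_divide_distrib)
  have "finite K" "finite L"
    using \<open>finite S\<close> by (auto simp: K_def L_def)
  then obtain U V where UV: "openin T U" "openin T V" "disjnt U V"
    and U: "\<And>\<beta> x. \<lbrakk>\<beta> \<in> K; x \<in> topspace T; pt_dist d x (F \<beta>) \<le> ennreal ((\<alpha> - \<beta>) / c + \<delta>/4)\<rbrakk> \<Longrightarrow> x \<in> U"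
    and V: "\<And>\<gamma> x. \<lbrakk>\<gamma> \<in> L; x \<in> topspace T; pt_dist d x (G \<gamma>) \<le> ennreal ((\<gamma> - \<alpha>) / c + \<delta>/4)\<rbrakk> \<Longrightarrow> x \<in> V"
    using normal_separate_balls[OF normal, where K=K and L=L and F=F and G=G and \<delta>=\<delta>
        and r="\<lambda>\<beta>. (\<alpha> - \<beta>) / c" and s="\<lambda>\<gamma>. (\<gamma> - \<alpha>) / c"]
      \<open>\<delta> > 0\<close> closed far \<open>c > 0\<close>
    by (auto simp: K_def L_def)
  have ext: "ext_metric_on (topspace T) d"
    using normal by (auto simp: normal_topometric_space_def topometric_space_def)
  have old: "\<exists>s > (\<gamma> - \<beta>) / c. \<forall>a\<in>F \<beta>. \<forall>b\<in>G \<gamma>. ennreal s \<le> d a b" if "\<beta> < \<gamma>" for \<beta> \<gamma>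
    using partial that \<open>c > 0\<close> by (simp add: partial_lipschitz_approximation_iff)
  \<comment> \<open>Points outside \<open>V\<close> are far from every \<open>G \<gamma>\<close>
    above \<open>\<alpha>\<close>, points outside \<open>U\<close> from every
    \<open>F \<beta>\<close> below; disjointness of \<open>U\<close> and \<open>V\<close> makes the
    complements cover the space. \<open>A\<close> and \<open>B\<close> may overlap, since only
    distinct levels are compared.\<close>
  define A where "A = F \<alpha> \<union> (topspace T - V)"
  define B where "B = G \<alpha> \<union> (topspace T - U)"
  have sub: "F \<beta> \<subseteq> topspace T" "G \<beta> \<subseteq> topspace T" for \<beta>
    using closed closedin_subset by blast+
  have cover: "A \<union> B = topspace T"
    using sub UV(3) by (auto simp: A_def B_def disjnt_iff)
  have farV: "ennreal ((\<gamma> - \<alpha>) / c + \<delta>/4) \<le> d x b"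
    if "\<gamma> > \<alpha>" "x \<in> topspace T - V" "b \<in> G \<gamma>" for x b \<gamma>
  proof -
    have "\<gamma> \<in> L"
      using that by (auto simp: L_def S_def)
    then have "pt_dist d x (G \<gamma>) \<ge> ennreal ((\<gamma> - \<alpha>) / c + \<delta>/4)"
      using V that by force
    also have "pt_dist d x (G \<gamma>) \<le> d x b"
      unfolding pt_dist_def using that by (auto intro: INF_lower)
    finally show ?thesis .
  qed
  have farU: "ennreal ((\<alpha> - \<beta>) / c + \<delta>/4) \<le> d a x"
    if "\<beta> < \<alpha>" "x \<in> topspace T - U" "a \<in> F \<beta>" for x a \<beta>
  proof -
    have "\<beta> \<in> K"
      using that by (auto simp: K_def S_def)
    then have "pt_dist d x (F \<beta>) \<ge> ennreal ((\<alpha> - \<beta>) / c + \<delta>/4)"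
      using U that by force
    also have "pt_dist d x (F \<beta>) \<le> d x a"
      unfolding pt_dist_def using that by (auto intro: INF_lower)
    also have "d x a = d a x"
      using ext_metric_on_commute[OF ext] that sub by auto
    finally show ?thesis .
  qed
  have newF: "\<exists>s > (\<gamma> - \<alpha>) / c. \<forall>a\<in>A. \<forall>b\<in>G \<gamma>. ennreal s \<le> d a b" if lt: "\<alpha> < \<gamma>" for \<gamma>
  proof -
    obtain s where s: "s > (\<gamma> - \<alpha>) / c" "\<forall>a\<in>F \<alpha>. \<forall>b\<in>G \<gamma>. ennreal s \<le> d a b"
      using old[OF lt] by blast
    \<comment> \<open>Points of \<open>F \<alpha>\<close> and points outside \<open>V\<close> come
      with different margins; the smaller bound still exceeds
      \<open>(\<gamma> - \<alpha>) / c\<close>.\<close>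
    have "ennreal (min s ((\<gamma> - \<alpha>) / c + \<delta>/4)) \<le> d a b" if "a \<in> A" "b \<in> G \<gamma>" for a b
    proof (cases "a \<in> F \<alpha>")
      case True
      then show ?thesis
        using order_trans[OF ennreal_leI, of _ s "d a b"] s(2) that by auto
    next
      case False
      then show ?thesis
        using order_trans[OF ennreal_leI farV[of \<gamma> a b]] that \<open>\<alpha> < \<gamma>\<close> unfolding A_def by auto
    qed
    then show ?thesis
      using s(1) \<open>\<delta> > 0\<close> by (intro exI[of _ "min s ((\<gamma> - \<alpha>) / c + \<delta>/4)"]) auto
  qed
  have newG: "\<exists>s > (\<alpha> - \<beta>) / c. \<forall>a\<in>F \<beta>. \<forall>b\<in>B. ennreal s \<le> d a b" if lt: "\<beta> < \<alpha>" for \<beta>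
  proof -
    obtain s where s: "s > (\<alpha> - \<beta>) / c" "\<forall>a\<in>F \<beta>. \<forall>b\<in>G \<alpha>. ennreal s \<le> d a b"
      using old[OF lt] by blast
    have "ennreal (min s ((\<alpha> - \<beta>) / c + \<delta>/4)) \<le> d a b" if "a \<in> F \<beta>" "b \<in> B" for a b
    proof (cases "b \<in> G \<alpha>")
      case True
      then show ?thesis
        using order_trans[OF ennreal_leI, of _ s "d a b"] s(2) that by auto
    next
      case False
      then show ?thesis
        using order_trans[OF ennreal_leI farU[of \<beta> b a]] that \<open>\<beta> < \<alpha>\<close> unfolding B_def by auto
    qed
    then show ?thesis
      using s(1) \<open>\<delta> > 0\<close> by (intro exI[of _ "min s ((\<alpha> - \<beta>) / c + \<delta>/4)"]) auto
  qed
  have "closedin T A" "closedin T B"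
    using closed UV by (auto simp: A_def B_def)
  then have "partial_lipschitz_approximation T d c UNIV (F(\<alpha> := A)) (G(\<alpha> := B))"
    unfolding partial_lipschitz_approximation_iff[OF \<open>c > 0\<close>]
    using closed old newF newG by simp
  then show thesis
    using cover by (intro that[of A B]) (auto simp: A_def B_def)
qed

text \<open>The levels of \<open>D\<close> are completed one after another. A stage changes a single
  level, so at every stage only finitely many members are nonempty, as the one-step completion
  demands. The members only grow, so any two levels of the limit can be compared inside one common
  stage.\<close>

lemma lipschitz_approximation_completion:
  assumes normal: "normal_topometric_space T d" and "c > 0"
    and partial: "partial_lipschitz_approximation T d c UNIV F G"
    and fin: "finite {\<alpha>. F \<alpha> \<noteq> {} \<or> G \<alpha> \<noteq> {}}" and "countable D"
  obtains F' G' where "lipschitz_approximation T d c D F' G'"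
    "\<forall>\<alpha>\<in>D. F \<alpha> \<subseteq> F' \<alpha> \<and> G \<alpha> \<subseteq> G' \<alpha>"
proof -
  define P where "P = (\<lambda>p. partial_lipschitz_approximation T d c UNIV (fst p) (snd p) \<and>
    finite {\<alpha>. fst p \<alpha> \<noteq> {} \<or> snd p \<alpha> \<noteq> {}} \<and> F \<le> fst p \<and> G \<le> snd p)"
  \<comment> \<open>\<open>from_nat_into D\<close> repeats levels if \<open>D\<close> is finite and
    yields an arbitrary real if \<open>D\<close> is empty; both are harmless because the one-step
    completion works at every real level.\<close>
  define R where "R = (\<lambda>n p p'. fst p \<le> fst p' \<and> snd p \<le> snd p' \<and>
    fst p' (from_nat_into D n) \<union> snd p' (from_nat_into D n) = topspace T)"
  have "\<exists>p'. P p' \<and> R n p p'" if p: "P p" for n p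
  proof -
    let ?\<alpha> = "from_nat_into D n"
    have pp: "partial_lipschitz_approximation T d c UNIV (fst p) (snd p)"
      "finite {\<alpha>. fst p \<alpha> \<noteq> {} \<or> snd p \<alpha> \<noteq> {}}"
      using p by (simp_all add: P_def)
    obtain A B where AB: "fst p ?\<alpha> \<subseteq> A" "snd p ?\<alpha> \<subseteq> B" "A \<union> B = topspace T"
      "partial_lipschitz_approximation T d c UNIV ((fst p)(?\<alpha> := A)) ((snd p)(?\<alpha> := B))"
      by (rule partial_lipschitz_approximation_complete_at[OF normal \<open>c > 0\<close> pp])
    let ?p' = "((fst p)(?\<alpha> := A), (snd p)(?\<alpha> := B))"
    have "{\<alpha>. fst ?p' \<alpha> \<noteq> {} \<or> snd ?p' \<alpha> \<noteq> {}} \<subseteq> insert ?\<alpha> {\<alpha>. fst p \<alpha> \<noteq> {} \<or> snd p \<alpha> \<noteq> {}}"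
      by auto
    then have "finite {\<alpha>. fst ?p' \<alpha> \<noteq> {} \<or> snd ?p' \<alpha> \<noteq> {}}"
      by (rule finite_subset) (use pp(2) in simp)
    moreover have mono: "fst p \<le> fst ?p'" "snd p \<le> snd ?p'"
      using AB by (auto simp: le_fun_def)
    moreover have "F \<le> fst ?p'" "G \<le> snd ?p'"
      using p mono unfolding P_def by (blast intro: order_trans)+
    ultimately have "P ?p' \<and> R n p ?p'"
      using AB(3,4) unfolding P_def R_def by simp
    then show ?thesis ..
  qed
  moreover have "P (F, G)"
    using partial fin by (simp add: P_def)
  ultimately obtain p where p: "\<And>n. P (p n)" "\<And>n. R n (p n) (p (Suc n))"
    using dependent_nat_choice[of "\<lambda>_. P" R] by blast
  have mono: "fst (p m) \<alpha> \<subseteq> fst (p n) \<alpha>" "snd (p m) \<alpha> \<subseteq> snd (p n) \<alpha>" if "m \<le> n" for m n \<alpha>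
    using lift_Suc_mono_le[of "\<lambda>n. fst (p n) \<alpha>", OF _ that]
      lift_Suc_mono_le[of "\<lambda>n. snd (p n) \<alpha>", OF _ that] p(2)
    by (auto simp: R_def le_fun_def)
  \<comment> \<open>Level number \<open>n\<close> becomes total in passing from stage
    \<open>n\<close> to stage \<open>Suc n\<close>, so it is read off at the later stage.\<close>
  define k where "k = (\<lambda>\<alpha>. Suc (to_nat_on D \<alpha>))"
  define F' where "F' = (\<lambda>\<alpha>. fst (p (k \<alpha>)) \<alpha>)"
  define G' where "G' = (\<lambda>\<alpha>. snd (p (k \<alpha>)) \<alpha>)"
  have part: "partial_lipschitz_approximation T d c UNIV (fst (p n)) (snd (p n))" for n
    using p(1) by (simp add: P_def)
  have "\<exists>s > (\<beta> - \<alpha>) / c. \<forall>a\<in>F' \<alpha>. \<forall>b\<in>G' \<beta>. ennreal s \<le> d a b" if "\<alpha> < \<beta>" for \<alpha> \<beta>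
  proof -
    let ?n = "max (k \<alpha>) (k \<beta>)"
    have "F' \<alpha> \<subseteq> fst (p ?n) \<alpha>" "G' \<beta> \<subseteq> snd (p ?n) \<beta>"
      unfolding F'_def G'_def by (intro mono; simp)+
    moreover have "\<exists>s > (\<beta> - \<alpha>) / c. \<forall>a\<in>fst (p ?n) \<alpha>. \<forall>b\<in>snd (p ?n) \<beta>. ennreal s \<le> d a b"
      using part[of ?n] that unfolding partial_lipschitz_approximation_iff[OF \<open>c > 0\<close>] by simp
    ultimately show ?thesis
      by (meson subsetD)
  qed
  moreover have "closedin T (F' \<alpha>)" "closedin T (G' \<alpha>)" for \<alpha>
    using part unfolding F'_def G'_def partial_lipschitz_approximation_def by simp_all
  ultimately have "partial_lipschitz_approximation T d c D F' G'"
    unfolding partial_lipschitz_approximation_iff[OF \<open>c > 0\<close>] by simp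
  moreover have "F' \<alpha> \<union> G' \<alpha> = topspace T" if "\<alpha> \<in> D" for \<alpha>
    using p(2)[of "to_nat_on D \<alpha>"] from_nat_into_to_nat_on[OF \<open>countable D\<close> that]
    by (simp add: F'_def G'_def k_def R_def)
  ultimately have "lipschitz_approximation T d c D F' G'"
    by (simp add: lipschitz_approximation_def)
  moreover have "F \<alpha> \<subseteq> F' \<alpha>" "G \<alpha> \<subseteq> G' \<alpha>" for \<alpha>
    using p(1)[of "k \<alpha>"] by (auto simp: P_def F'_def G'_def le_fun_def)
  ultimately show thesis
    using that by blast
qed

section \<open>From approximations to functions\<close>

text \<open>For \<alpha> < \<beta> the distance bound makes \<open>F \<alpha>\<close> and
  \<open>G \<beta>\<close> disjoint. With totality and dense levels, the set where
  \<open>h < t\<close> is then the union of the complements of the \<open>G \<alpha>\<close> with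
  \<alpha> < t, and the set where \<open>h > t\<close> that of the complements of the
  \<open>F \<alpha>\<close> with \<alpha> > t, so both are open. The Lipschitz bound compares levels
  close to \<open>h x\<close> and \<open>h y\<close>.\<close>

lemma dense_lipschitz_approximation_approximates:
  assumes ext: "ext_metric_on (topspace T) d" and "c > 0" "m < M"
    and D: "D \<subseteq> {m..M}" "\<And>u v. \<lbrakk>m \<le> u; u < v; v \<le> M\<rbrakk> \<Longrightarrow> \<exists>\<alpha>\<in>D. u < \<alpha> \<and> \<alpha> < v"
    and total: "lipschitz_approximation T d c D F G"
  obtains h where "continuous_map T (top_of_set {m..M}) h" "lipschitz_fun_on c d (topspace T) h"
    "approximates D F G h"
proof -
  have closed: "closedin T (F \<alpha>)" "closedin T (G \<alpha>)" and cover: "F \<alpha> \<union> G \<alpha> = topspace T"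
    if "\<alpha> \<in> D" for \<alpha>
    using total that
    unfolding lipschitz_approximation_def partial_lipschitz_approximation_def by auto
  have dist: "ennreal ((\<beta> - \<alpha>) / c) < d a b"
    if ab: "\<alpha> \<in> D" "\<beta> \<in> D" "\<alpha> < \<beta>" "a \<in> F \<alpha>" "b \<in> G \<beta>" for \<alpha> \<beta> a b
  proof -
    have "\<exists>s > (\<beta> - \<alpha>) / c. \<forall>a\<in>F \<alpha>. \<forall>b\<in>G \<beta>. ennreal s \<le> d a b"
      using total ab(1-3) unfolding lipschitz_approximation_def
        partial_lipschitz_approximation_iff[OF \<open>c > 0\<close>] by simp
    then obtain s where s: "s > (\<beta> - \<alpha>) / c" "ennreal s \<le> d a b"
      using ab(4,5) by blast
    have "ennreal ((\<beta> - \<alpha>) / c) < ennreal s"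
      using s(1) ab(3) \<open>c > 0\<close> by (simp add: ennreal_less_iff)
    then show ?thesis
      using s(2) by (rule less_le_trans)
  qed
  have disj: "F \<alpha> \<inter> G \<beta> = {}" if "\<alpha> \<in> D" "\<beta> \<in> D" "\<alpha> < \<beta>" for \<alpha> \<beta>
  proof (rule ccontr)
    assume "F \<alpha> \<inter> G \<beta> \<noteq> {}"
    then obtain x where x: "x \<in> F \<alpha>" "x \<in> G \<beta>"
      by blast
    then have "d x x = 0"
      using cover[OF that(1)] ext unfolding ext_metric_on_def by blast
    then show False
      using dist[OF that x] by simp
  qed
  \<comment> \<open>\<open>M\<close> is the value at points lying in no \<open>F \<alpha>\<close>;
    it keeps the set nonempty.\<close>
  define h where "h = (\<lambda>x. Inf (insert M {\<alpha> \<in> D. x \<in> F \<alpha>}))"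
  have bdd: "bdd_below (insert M {\<alpha> \<in> D. x \<in> F \<alpha>})" for x
    using D(1) \<open>m < M\<close> by (intro bdd_belowI[of _ m]) auto
  have h_le: "h x \<le> \<alpha>" if "\<alpha> \<in> D" "x \<in> F \<alpha>" for x \<alpha>
    unfolding h_def using that by (intro cInf_lower bdd) auto
  have h_ge: "\<alpha> \<le> h x" if \<alpha>: "\<alpha> \<in> D" "x \<in> G \<alpha>" for x \<alpha>
    unfolding h_def
  proof (rule cInf_greatest)
    fix \<beta> assume "\<beta> \<in> insert M {\<beta> \<in> D. x \<in> F \<beta>}"
    then show "\<alpha> \<le> \<beta>"
      using disj[OF _ \<alpha>(1), of \<beta>] \<alpha> D(1) by force
  qed auto
  have h_range: "m \<le> h x" "h x \<le> M" for x
    unfolding h_def using D(1) \<open>m < M\<close> bdd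
    by (auto intro!: cInf_greatest cInf_lower)
  have less: "\<exists>\<alpha>\<in>D. \<alpha> < t \<and> x \<in> F \<alpha> \<and> x \<notin> G \<alpha>" if t: "h x < t" "t \<le> M" for x t
  proof -
    obtain \<alpha> where \<alpha>: "\<alpha> \<in> D" "x \<in> F \<alpha>" "\<alpha> < t"
      using t cInf_less_iff[OF _ bdd[of x], of t] unfolding h_def by auto
    \<comment> \<open>\<open>x\<close> may lie in both \<open>F \<alpha>\<close> and
      \<open>G \<alpha>\<close>. At a second level below \<open>t\<close> it is outside
      \<open>G \<beta>\<close> by disjointness, hence inside \<open>F \<beta>\<close> by
      totality.\<close>
    moreover obtain \<beta> where \<beta>: "\<beta> \<in> D" "\<alpha> < \<beta>" "\<beta> < t"
      using D \<alpha> t by (meson atLeastAtMost_iff subsetD)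
    moreover have "x \<notin> G \<beta>"
      using disj[OF \<alpha>(1) \<beta>(1,2)] \<alpha> by blast
    moreover have "x \<in> topspace T"
      using cover[OF \<alpha>(1)] \<alpha>(2) by blast
    ultimately show ?thesis
      using cover[OF \<beta>(1)] by blast
  qed
  have greater: "\<exists>\<alpha>\<in>D. t < \<alpha> \<and> x \<in> G \<alpha> \<and> x \<notin> F \<alpha>" if t: "t < h x" "m \<le> t" "x \<in> topspace T" for x t
  proof -
    obtain \<alpha> where \<alpha>: "\<alpha> \<in> D" "t < \<alpha>" "\<alpha> < h x"
      using D(2)[of t "h x"] t h_range by blast
    then have "x \<notin> F \<alpha>"
      using h_le[of \<alpha> x] by auto
    then show ?thesis
      using \<alpha> cover[OF \<alpha>(1)] t(3) by blast
  qed
  have "openin T {x \<in> topspace T. h x < t}" for t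
  proof (cases "t \<le> M")
    case True
    have "{x \<in> topspace T. h x < t} = (\<Union>\<alpha>\<in>{\<alpha> \<in> D. \<alpha> < t}. topspace T - G \<alpha>)"
    proof (intro equalityI subsetI)
      fix x assume "x \<in> {x \<in> topspace T. h x < t}"
      then show "x \<in> (\<Union>\<alpha>\<in>{\<alpha> \<in> D. \<alpha> < t}. topspace T - G \<alpha>)"
        using less[of x t] True by auto
    next
      fix x assume "x \<in> (\<Union>\<alpha>\<in>{\<alpha> \<in> D. \<alpha> < t}. topspace T - G \<alpha>)"
      then obtain \<alpha> where "\<alpha> \<in> D" "\<alpha> < t" "x \<in> topspace T" "x \<in> F \<alpha>"
        using cover by blast
      then show "x \<in> {x \<in> topspace T. h x < t}"
        using h_le[of \<alpha> x] by simp
    qed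
    also have "openin T \<dots>"
      using closed by (intro openin_Union) auto
    finally show ?thesis .
  next
    case False
    have "h x < t" for x
      using h_range(2)[of x] False by linarith
    then show ?thesis
      by simp
  qed
  moreover have "openin T {x \<in> topspace T. h x > t}" for t
  proof (cases "m \<le> t")
    case True
    have "{x \<in> topspace T. h x > t} = (\<Union>\<alpha>\<in>{\<alpha> \<in> D. \<alpha> > t}. topspace T - F \<alpha>)"
    proof (intro equalityI subsetI)
      fix x assume "x \<in> {x \<in> topspace T. h x > t}"
      then show "x \<in> (\<Union>\<alpha>\<in>{\<alpha> \<in> D. \<alpha> > t}. topspace T - F \<alpha>)"
        using greater[of t x] True by auto
    next
      fix x assume "x \<in> (\<Union>\<alpha>\<in>{\<alpha> \<in> D. \<alpha> > t}. topspace T - F \<alpha>)"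
      then obtain \<alpha> where "\<alpha> \<in> D" "\<alpha> > t" "x \<in> topspace T" "x \<in> G \<alpha>"
        using cover by blast
      then show "x \<in> {x \<in> topspace T. h x > t}"
        using h_ge[of \<alpha> x] by simp
    qed
    also have "openin T \<dots>"
      using closed by (intro openin_Union) auto
    finally show ?thesis .
  next
    case False
    have "h x > t" for x
      using h_range(1)[of x] False by linarith
    then show ?thesis
      by simp
  qed
  ultimately have "continuous_map T euclideanreal h"
    unfolding continuous_map_upper_lower_semicontinuous_lt by blast
  then have "continuous_map T (top_of_set {m..M}) h"
    using h_range by (auto simp: continuous_map_in_subtopology)
  moreover have lip: "ennreal ((h y - h x) / c) \<le> d x y"
    if xy: "x \<in> topspace T" "y \<in> topspace T" "h x < h y" for x y
  proof (rule ccontr)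
    assume "\<not> ennreal ((h y - h x) / c) \<le> d x y"
    then have lt: "d x y < ennreal ((h y - h x) / c)"
      by simp
    then obtain u where u: "d x y = ennreal u" "u \<ge> 0"
      by (cases "d x y") auto
    \<comment> \<open>Half the excess of \<open>h y - h x\<close> over \<open>c * u\<close>: a level
      below \<open>h x + e\<close> and one above \<open>h y - e\<close> still differ by more than
      \<open>c * u\<close>.\<close>
    define e where "e = (h y - h x - c * u) / 2"
    have "e > 0"
      using lt u \<open>c > 0\<close> by (simp add: e_def ennreal_less_iff field_simps)
    have "0 \<le> c * u"
      using u \<open>c > 0\<close> by simp
    \<comment> \<open>Keeps the shifted values inside \<open>{m..M}\<close>, where the levels are
      dense.\<close>
    then have "e \<le> h y - h x"
      using xy(3) by (simp add: e_def field_simps)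
    have eM: "h x + e \<le> M" "m \<le> h y - e"
      using h_range[of x] h_range[of y] \<open>e \<le> h y - h x\<close> by linarith+
    obtain \<alpha> where \<alpha>: "\<alpha> \<in> D" "\<alpha> < h x + e" "x \<in> F \<alpha>"
      using less[of x "h x + e"] \<open>e > 0\<close> eM by auto
    obtain \<beta> where \<beta>: "\<beta> \<in> D" "\<beta> > h y - e" "y \<in> G \<beta>"
      using greater[of "h y - e" y] \<open>e > 0\<close> eM xy by auto
    have "c * u < \<beta> - \<alpha>"
      using \<alpha>(2) \<beta>(2) by (simp add: e_def field_simps)
    then have "\<alpha> < \<beta>"
      using \<open>0 \<le> c * u\<close> by linarith
    then have "ennreal ((\<beta> - \<alpha>) / c) < ennreal u"
      using dist[OF \<alpha>(1) \<beta>(1) _ \<alpha>(3) \<beta>(3)] u by simp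
    then have "(\<beta> - \<alpha>) / c < u"
      using \<open>\<alpha> < \<beta>\<close> \<open>c > 0\<close> by (simp add: ennreal_less_iff)
    then show False
      using \<open>c * u < \<beta> - \<alpha>\<close> \<open>c > 0\<close> by (simp add: field_simps)
  qed
  have "ennreal (\<bar>h x - h y\<bar> / c) \<le> d x y" if xy: "x \<in> topspace T" "y \<in> topspace T" for x y
    using lip[OF xy] lip[OF xy(2,1)] ext_metric_on_commute[OF ext xy]
    by (cases "h x" "h y" rule: linorder_cases) auto
  then have "lipschitz_fun_on c d (topspace T) h"
    using lipschitz_fun_on_iff[OF \<open>c > 0\<close>] by blast
  moreover have "approximates D F G h"
    using h_le h_ge by (simp add: approximates_def)
  ultimately show thesis
    by (rule that)
qed

text \<open>A partial approximation suffices because the completion supplies totality; the extension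
  argument produces approximations of this kind.\<close>

lemma normal_partial_lipschitz_approximation_approximates:
  assumes normal: "normal_topometric_space T d" and "c > 0" "finite S" "S \<subseteq> {m..M}" "m < M"
    and partial: "partial_lipschitz_approximation T d c S F G"
  obtains h where "continuous_map T (top_of_set {m..M}) h" "lipschitz_fun_on c d (topspace T) h"
    "approximates S F G h"
proof -
  define F0 where "F0 = (\<lambda>\<alpha>. if \<alpha> \<in> S then F \<alpha> else {})"
  define G0 where "G0 = (\<lambda>\<alpha>. if \<alpha> \<in> S then G \<alpha> else {})"
  have ext: "ext_metric_on (topspace T) d"
    using normal by (simp add: normal_topometric_space_def topometric_space_def)
  have part0: "partial_lipschitz_approximation T d c UNIV F0 G0"
    using partial unfolding partial_lipschitz_approximation_iff[OF \<open>c > 0\<close>]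
    by (simp add: F0_def G0_def gt_ex)
  have fin0: "finite {\<alpha>. F0 \<alpha> \<noteq> {} \<or> G0 \<alpha> \<noteq> {}}"
    using \<open>finite S\<close> by (rule rev_finite_subset) (auto simp: F0_def G0_def)
  \<comment> \<open>The rationals provide density; \<open>S\<close> is added because its levels may
    be irrational and must be kept.\<close>
  define D where "D = S \<union> (\<rat> \<inter> {m..M})"
  have D: "countable D"
    using \<open>finite S\<close> countable_rat by (auto simp: D_def countable_finite)
  obtain F' G' where FG: "lipschitz_approximation T d c D F' G'"
    "\<forall>\<alpha>\<in>D. F0 \<alpha> \<subseteq> F' \<alpha> \<and> G0 \<alpha> \<subseteq> G' \<alpha>"
    by (rule lipschitz_approximation_completion[OF normal \<open>c > 0\<close> part0 fin0 D])
  have "D \<subseteq> {m..M}"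
    using \<open>S \<subseteq> {m..M}\<close> by (auto simp: D_def)
  moreover have "\<exists>\<alpha>\<in>D. u < \<alpha> \<and> \<alpha> < v" if "m \<le> u" "u < v" "v \<le> M" for u v
    using Rats_dense_in_real[OF \<open>u < v\<close>] that by (force simp: D_def)
  ultimately obtain h where h: "continuous_map T (top_of_set {m..M}) h"
    "lipschitz_fun_on c d (topspace T) h" "approximates D F' G' h"
    using dense_lipschitz_approximation_approximates[OF ext \<open>c > 0\<close> \<open>m < M\<close> _ _ FG(1)] by blast
  have SD: "\<alpha> \<in> D" if "\<alpha> \<in> S" for \<alpha>
    using that by (simp add: D_def)
  have "F \<alpha> \<subseteq> F' \<alpha>" "G \<alpha> \<subseteq> G' \<alpha>" if "\<alpha> \<in> S" for \<alpha>
    using bspec[OF FG(2) SD[OF that]] that by (simp_all add: F0_def G0_def)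
  then have "approximates S F G h"
    using h(3) SD unfolding approximates_def by blast
  then show thesis
    using h(1,2) that by blast
qed

section \<open>Extending Lipschitz functions by successive improvement\<close>

text \<open>The net consists of multiples of \<open>1 / n\<close> and contains 0 and 1, so rounding
  in either direction stays in the unit interval. Rounding down is rounding up after the reflection
  \<open>u \<mapsto> 1 - u\<close>.\<close>

lemma finite_subset_net_unit_interval:
  assumes "(\<delta>::real) > 0"
  obtains S where "finite S" "S \<subseteq> {0..1}"
    "\<And>u. \<lbrakk>0 \<le> u; u \<le> 1\<rbrakk> \<Longrightarrow> \<exists>\<alpha>\<in>S. u \<le> \<alpha> \<and> \<alpha> \<le> u + \<delta>"
    "\<And>u. \<lbrakk>0 \<le> u; u \<le> 1\<rbrakk> \<Longrightarrow> \<exists>\<alpha>\<in>S. u - \<delta> \<le> \<alpha> \<and> \<alpha> \<le> u"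
proof -
  obtain n :: nat where n: "n > 0" "1 / real n < \<delta>"
    using assms by (metis inverse_eq_divide neq0_conv real_arch_inverse)
  define S where "S = (\<lambda>j. real j / real n) ` {..n}"
  have up: "\<exists>\<alpha>\<in>S. u \<le> \<alpha> \<and> \<alpha> \<le> u + \<delta>" if u: "0 \<le> u" "u \<le> 1" for u
  proof -
    let ?j = "nat \<lceil>u * real n\<rceil>"
    have "0 \<le> u * real n" "u * real n \<le> real n"
      using u by (simp_all add: mult_left_le_one_le)
    then have "?j \<le> n"
      by linarith
    moreover have "u * real n \<le> real ?j" "real ?j \<le> u * real n + 1"
      using \<open>0 \<le> u * real n\<close> by linarith+
    then have "u \<le> real ?j / real n" "real ?j / real n \<le> u + 1 / real n"
      using n(1) by (simp_all add: field_simps)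
    ultimately show ?thesis
      using n(2) by (intro bexI[of _ "real ?j / real n"]) (auto simp: S_def)
  qed
  have "finite S"
    by (simp add: S_def)
  moreover have "S \<subseteq> {0..1}"
    using n(1) by (auto simp: S_def)
  moreover have "\<exists>\<alpha>\<in>S. u - \<delta> \<le> \<alpha> \<and> \<alpha> \<le> u" if u: "0 \<le> u" "u \<le> 1" for u
  proof -
    obtain \<alpha> where "\<alpha> \<in> S" "1 - u \<le> \<alpha>" "\<alpha> \<le> 1 - u + \<delta>"
      using up[of "1 - u"] u by auto
    moreover have "1 - \<alpha> \<in> S"
    proof -
      obtain j where j: "j \<le> n" "\<alpha> = real j / real n"
        using \<open>\<alpha> \<in> S\<close> by (auto simp: S_def)
      then have "1 - \<alpha> = real (n - j) / real n"
        using n(1) by (simp add: of_nat_diff diff_divide_distrib)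
      then show ?thesis
        unfolding S_def by auto
    qed
    ultimately show ?thesis
      by (intro bexI[of _ "1 - \<alpha>"]) auto
  qed
  ultimately show thesis
    using that up by blast
qed

text \<open>The new function is tied to \<open>f\<close> on \<open>Y\<close> at levels of mesh
  \<open>\<epsilon> / 2\<close>, but to \<open>g\<close> only up to a shift by
  \<open>\<epsilon>\<close>. The looser tie makes the two constraints compatible, because
  \<open>g\<close> itself may miss \<open>f\<close> by \<open>\<epsilon>\<close>.\<close>

lemma lipschitz_extension_improve:
  assumes normal: "normal_topometric_space T d" and "0 < b" "c \<le> b" "b < b'"
    and Y: "closedin T Y"
    and f: "continuous_map (subtopology T Y) (top_of_set {0..1}) f" "lipschitz_fun_on c d Y f"
    and g: "continuous_map T (top_of_set {0..1}) g" "lipschitz_fun_on b d (topspace T) g"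
    and "\<epsilon> > 0" and close: "\<And>y. y \<in> Y \<Longrightarrow> \<bar>g y - f y\<bar> \<le> \<epsilon>"
  obtains g' where "continuous_map T (top_of_set {0..1}) g'" "lipschitz_fun_on b' d (topspace T) g'"
    "\<And>y. y \<in> Y \<Longrightarrow> \<bar>g' y - f y\<bar> \<le> \<epsilon> / 2"
    "\<And>x. x \<in> topspace T \<Longrightarrow> \<bar>g' x - g x\<bar> \<le> 2 * \<epsilon>"
proof -
  obtain S where S: "finite S" "S \<subseteq> {0..1}"
    "\<And>u. \<lbrakk>0 \<le> u; u \<le> 1\<rbrakk> \<Longrightarrow> \<exists>\<alpha>\<in>S. u \<le> \<alpha> \<and> \<alpha> \<le> u + \<epsilon> / 2"
    "\<And>u. \<lbrakk>0 \<le> u; u \<le> 1\<rbrakk> \<Longrightarrow> \<exists>\<alpha>\<in>S. u - \<epsilon> / 2 \<le> \<alpha> \<and> \<alpha> \<le> u"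
    using finite_subset_net_unit_interval[of "\<epsilon> / 2"] \<open>\<epsilon> > 0\<close> by auto
  define F where "F = (\<lambda>\<alpha>. {y \<in> Y. f y \<le> \<alpha>} \<union> {x \<in> topspace T. g x \<le> \<alpha> - \<epsilon>})"
  define G where "G = (\<lambda>\<alpha>. {y \<in> Y. \<alpha> \<le> f y} \<union> {x \<in> topspace T. \<alpha> + \<epsilon> \<le> g x})"
  have YT: "Y \<subseteq> topspace T"
    using Y by (rule closedin_subset)
  have "b' > 0"
    using assms by linarith
  have lipf: "ennreal (\<bar>f x - f y\<bar> / b) \<le> d x y" if "x \<in> Y" "y \<in> Y" for x y
    using lipschitz_fun_on_mono[OF f(2) \<open>c \<le> b\<close>] that
    unfolding lipschitz_fun_on_iff[OF \<open>b > 0\<close>] by blast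
  have lipg: "ennreal (\<bar>g x - g y\<bar> / b) \<le> d x y" if "x \<in> topspace T" "y \<in> topspace T" for x y
    using g(2) that unfolding lipschitz_fun_on_iff[OF \<open>b > 0\<close>] by blast
  have Yf: "topspace (subtopology T Y) = Y"
    by (rule topspace_subtopology_subset[OF YT])
  have "closedin (subtopology T Y) {y \<in> Y. f y \<le> \<alpha>}" "closedin (subtopology T Y) {y \<in> Y. \<alpha> \<le> f y}" for \<alpha>
    using f(1) unfolding continuous_map_upper_lower_semicontinuous_le_gen Yf by blast+
  then have "closedin T {y \<in> Y. f y \<le> \<alpha>}" "closedin T {y \<in> Y. \<alpha> \<le> f y}" for \<alpha>
    using closedin_trans_full Y by blast+
  moreover have "closedin T {x \<in> topspace T. g x \<le> \<alpha>}" "closedin T {x \<in> topspace T. \<alpha> \<le> g x}" for \<alpha>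
    using g(1) unfolding continuous_map_upper_lower_semicontinuous_le_gen by blast+
  ultimately have "closedin T (F \<alpha>)" "closedin T (G \<alpha>)" for \<alpha>
    unfolding F_def G_def by (blast intro: closedin_Un)+
  moreover have "\<exists>s > (\<beta> - \<alpha>) / b'. \<forall>x\<in>F \<alpha>. \<forall>y\<in>G \<beta>. ennreal s \<le> d x y" if "\<alpha> < \<beta>" for \<alpha> \<beta>
  proof -
    have "ennreal ((\<beta> - \<alpha>) / b) \<le> d x y" if FG: "x \<in> F \<alpha>" "y \<in> G \<beta>" for x y
    proof -
      have xy: "x \<in> topspace T" "y \<in> topspace T"
        using FG YT unfolding F_def G_def by blast+
      \<comment> \<open>If \<open>f\<close> controls both points, or \<open>g\<close> does, the
        bound is direct. In a mixed case, \<open>g\<close> differs from \<open>f\<close> by at most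
        \<open>\<epsilon>\<close> at the point of \<open>Y\<close>, and the shift at the other point
        compensates for this, so \<open>g\<close> alone changes by at least
        \<open>\<beta> - \<alpha>\<close>.\<close>
      consider "x \<in> Y" "y \<in> Y" "\<beta> - \<alpha> \<le> \<bar>f x - f y\<bar>" | "\<beta> - \<alpha> \<le> \<bar>g x - g y\<bar>"
        using FG close[of x] close[of y] \<open>\<epsilon> > 0\<close> unfolding F_def G_def by force
      then show ?thesis
      proof cases
        case 1
        have "ennreal ((\<beta> - \<alpha>) / b) \<le> ennreal (\<bar>f x - f y\<bar> / b)"
          using 1(3) \<open>b > 0\<close> by (intro ennreal_leI divide_right_mono) auto
        also have "\<dots> \<le> d x y"
          by (rule lipf[OF 1(1,2)])
        finally show ?thesis .
      next
        case 2
        have "ennreal ((\<beta> - \<alpha>) / b) \<le> ennreal (\<bar>g x - g y\<bar> / b)"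
          using 2 \<open>b > 0\<close> by (intro ennreal_leI divide_right_mono) auto
        also have "\<dots> \<le> d x y"
          by (rule lipg[OF xy])
        finally show ?thesis .
      qed
    qed
    \<comment> \<open>The bound for the constant \<open>b\<close> is not strict; passing to
      \<open>b'\<close> supplies the margin.\<close>
    moreover have "(\<beta> - \<alpha>) / b' < (\<beta> - \<alpha>) / b"
      using that \<open>0 < b\<close> \<open>b < b'\<close> by (intro divide_strict_left_mono) auto
    ultimately show ?thesis
      by blast
  qed
  ultimately have "partial_lipschitz_approximation T d b' S F G"
    unfolding partial_lipschitz_approximation_iff[OF \<open>b' > 0\<close>] by blast
  then obtain g' where g': "continuous_map T (top_of_set {0..1}) g'"
    "lipschitz_fun_on b' d (topspace T) g'" "approximates S F G g'"
    using normal_partial_lipschitz_approximation_approximates[OF normal \<open>b' > 0\<close> S(1,2) zero_less_one]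
    by blast
  have range: "0 \<le> g x" "g x \<le> 1" "0 \<le> g' x" "g' x \<le> 1" if "x \<in> topspace T" for x
    using g(1) g'(1) that unfolding continuous_map_upper_lower_semicontinuous_le_gen by auto
  have rangef: "0 \<le> f y" "f y \<le> 1" if "y \<in> Y" for y
    using f(1) that unfolding continuous_map_upper_lower_semicontinuous_le_gen Yf by auto
  have up: "g' x \<le> \<alpha>" if "\<alpha> \<in> S" "x \<in> F \<alpha>" for x \<alpha>
    using g'(3) that unfolding approximates_def by blast
  have low: "\<alpha> \<le> g' x" if "\<alpha> \<in> S" "x \<in> G \<alpha>" for x \<alpha>
    using g'(3) that unfolding approximates_def by blast
  have "\<bar>g' y - f y\<bar> \<le> \<epsilon> / 2" if y: "y \<in> Y" for y
  proof -
    obtain \<alpha> where "\<alpha> \<in> S" "f y \<le> \<alpha>" "\<alpha> \<le> f y + \<epsilon> / 2"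
      using S(3)[OF rangef[OF y]] by blast
    moreover from this have "g' y \<le> \<alpha>"
      using y by (intro up) (auto simp: F_def)
    moreover obtain \<beta> where "\<beta> \<in> S" "f y - \<epsilon> / 2 \<le> \<beta>" "\<beta> \<le> f y"
      using S(4)[OF rangef[OF y]] by blast
    moreover from this have "\<beta> \<le> g' y"
      using y by (intro low) (auto simp: G_def)
    ultimately show ?thesis
      by linarith
  qed
  moreover have "\<bar>g' x - g x\<bar> \<le> 2 * \<epsilon>" if x: "x \<in> topspace T" for x
  proof -
    have "g' x \<le> g x + 2 * \<epsilon>"
    \<comment> \<open>Rounding up adds at most \<open>\<epsilon> / 2\<close> to the shift
      \<open>\<epsilon>\<close>. If the shifted value exceeds 1, no level lies above it, but
      \<open>g' x \<le> 1\<close> suffices.\<close>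
    proof (cases "g x + \<epsilon> \<le> 1")
      case True
      then obtain \<alpha> where "\<alpha> \<in> S" "g x + \<epsilon> \<le> \<alpha>" "\<alpha> \<le> g x + \<epsilon> + \<epsilon> / 2"
        using S(3)[of "g x + \<epsilon>"] range(1)[OF x] \<open>\<epsilon> > 0\<close> by auto
      moreover from this have "g' x \<le> \<alpha>"
        using x by (intro up) (auto simp: F_def)
      ultimately show ?thesis
        using \<open>\<epsilon> > 0\<close> by linarith
    next
      case False
      then show ?thesis
        using range(4)[OF x] \<open>\<epsilon> > 0\<close> by linarith
    qed
    moreover have "g x - 2 * \<epsilon> \<le> g' x"
    proof (cases "0 \<le> g x - \<epsilon>")
      case True
      then obtain \<alpha> where "\<alpha> \<in> S" "g x - \<epsilon> - \<epsilon> / 2 \<le> \<alpha>" "\<alpha> \<le> g x - \<epsilon>"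
        using S(4)[of "g x - \<epsilon>"] range(2)[OF x] \<open>\<epsilon> > 0\<close> by auto
      moreover from this have "\<alpha> \<le> g' x"
        using x by (intro low) (auto simp: G_def)
      ultimately show ?thesis
        using \<open>\<epsilon> > 0\<close> by linarith
    next
      case False
      then show ?thesis
        using range(3)[OF x] \<open>\<epsilon> > 0\<close> by linarith
    qed
    ultimately show ?thesis
      by linarith
  qed
  ultimately show thesis
    using that g'(1,2) by blast
qed

lemma lipschitz_fun_on_LIMSEQ:
  assumes lip: "\<And>n. lipschitz_fun_on c d A (f n)" and lim: "\<And>x. x \<in> A \<Longrightarrow> (\<lambda>n. f n x) \<longlonglongrightarrow> g x"
  shows "lipschitz_fun_on c d A g"
  unfolding lipschitz_fun_on_def
proof (intro ballI)
  fix x y assume xy: "x \<in> A" "y \<in> A"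
  have "(\<lambda>n. ennreal \<bar>f n x - f n y\<bar>) \<longlonglongrightarrow> ennreal \<bar>g x - g y\<bar>"
    using lim xy by (intro tendsto_intros) auto
  then show "ennreal \<bar>g x - g y\<bar> \<le> ennreal c * d x y"
    by (rule LIMSEQ_le_const2) (use lip xy in \<open>auto simp: lipschitz_fun_on_def\<close>)
qed

lemma normal_lipschitz_extension:
  assumes normal: "normal_topometric_space T d" and "0 \<le> c" "c < c'" and Y: "closedin T Y"
    and f: "continuous_map (subtopology T Y) (top_of_set {0..1}) f" "lipschitz_fun_on c d Y f"
  obtains g where "continuous_map T (top_of_set {0..1}) g" "lipschitz_fun_on c' d (topspace T) g"
    "\<forall>y\<in>Y. g y = f y"
proof -
  \<comment> \<open>The constants increase strictly towards \<open>c'\<close> from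
    \<open>(c + c') / 2\<close>, which is positive even for \<open>c = 0\<close>.\<close>
  define b where "b = (\<lambda>k::nat. c' - (c' - c) / 2 * (1/2) ^ k)"
  have half_le: "(1/2::real) ^ k \<le> 1" for k
    by (simp add: power_le_one)
  have b: "0 < b k" "c \<le> b k" "b k < b (Suc k)" "b k \<le> c'" for k
  proof -
    define e where "e = (c' - c) / 2 * (1/2) ^ k"
    have "e \<le> (c' - c) / 2"
      using half_le[of k] \<open>c < c'\<close> by (simp add: e_def mult_left_le)
    moreover have "b k = c' - e"
      by (simp add: b_def e_def)
    ultimately show "c \<le> b k" "0 < b k"
      using \<open>0 \<le> c\<close> \<open>c < c'\<close> by simp_all
    show "b k < b (Suc k)" "b k \<le> c'"
      using \<open>c < c'\<close> by (simp_all add: b_def)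
  qed
  have YT: "Y \<subseteq> topspace T"
    using Y by (rule closedin_subset)
  have rangef: "0 \<le> f y \<and> f y \<le> 1" if "y \<in> Y" for y
    using f(1) that YT unfolding continuous_map_upper_lower_semicontinuous_le_gen
    by auto
  define P where "P = (\<lambda>k g. continuous_map T (top_of_set {0..1}) g \<and>
    lipschitz_fun_on (b k) d (topspace T) g \<and> (\<forall>y\<in>Y. \<bar>g y - f y\<bar> \<le> (1/2) ^ k))"
  define R where "R = (\<lambda>k::nat. \<lambda>g g'. \<forall>x\<in>topspace T. \<bar>g' x - g x\<bar> \<le> 2 * (1/2::real) ^ k)"
  \<comment> \<open>\<open>f\<close> takes values in the unit interval, so the zero function has
    error at most 1.\<close>
  have "P 0 (\<lambda>x. 0)"
    using rangef by (auto simp: P_def lipschitz_fun_on_def)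
  moreover have "\<exists>g'. P (Suc k) g' \<and> R k g g'" if "P k g" for k g
  proof -
    have g: "continuous_map T (top_of_set {0..1}) g" "lipschitz_fun_on (b k) d (topspace T) g"
      "\<And>y. y \<in> Y \<Longrightarrow> \<bar>g y - f y\<bar> \<le> (1/2) ^ k"
      using that by (simp_all add: P_def)
    have "(1/2::real) ^ k > 0"
      by simp
    from lipschitz_extension_improve[OF normal b(1,2,3) Y f g(1,2) this g(3)]
    obtain g' where "continuous_map T (top_of_set {0..1}) g'"
      "lipschitz_fun_on (b (Suc k)) d (topspace T) g'"
      "\<And>y. y \<in> Y \<Longrightarrow> \<bar>g' y - f y\<bar> \<le> (1/2) ^ k / 2"
      "\<And>x. x \<in> topspace T \<Longrightarrow> \<bar>g' x - g x\<bar> \<le> 2 * (1/2) ^ k"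
      by blast
    then show ?thesis
      by (intro exI[of _ g']) (simp add: P_def R_def)
  qed
  ultimately obtain g where P: "\<And>k. P k (g k)" and R: "\<And>k. R k (g k) (g (Suc k))"
    using dependent_nat_choice[of P R] by blast
  \<comment> \<open>The closed form of the geometric sum of the changes
    \<open>2 * (1/2) ^ k\<close>; keeping the subtracted term makes the induction on
    \<open>j\<close> go through.\<close>
  have diff: "\<bar>g (m + j) x - g m x\<bar> \<le> 4 * (1/2) ^ m - 4 * (1/2) ^ (m + j)"
    if "x \<in> topspace T" for m j x
  proof (induction j)
    case (Suc j)
    have "\<bar>g (Suc (m + j)) x - g (m + j) x\<bar> \<le> 2 * (1/2) ^ (m + j)"
      using R that by (simp add: R_def)
    then show ?case
      using Suc by simp
  qed simp
  have cauchy: "\<exists>N. \<forall>m n x. N \<le> m \<longrightarrow> N \<le> n \<longrightarrow> x \<in> topspace T \<longrightarrow> dist (g m x) (g n x) < e"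
    if "e > 0" for e :: real
  proof -
    obtain N where N: "(1/2::real) ^ N < e / 8"
      using \<open>e > 0\<close> real_arch_pow_inv[of "e / 8" "1/2"] by auto
    have near: "\<bar>g m x - g N x\<bar> < e / 2" if "N \<le> m" "x \<in> topspace T" for m x
    proof -
      have "\<bar>g m x - g N x\<bar> \<le> 4 * (1/2) ^ N - 4 * (1/2) ^ m"
        using diff[OF that(2), of N "m - N"] that(1) by simp
      also have "\<dots> \<le> 4 * (1/2) ^ N"
        by simp
      finally show ?thesis
        using N by linarith
    qed
    have "dist (g m x) (g n x) < e" if "N \<le> m" "N \<le> n" "x \<in> topspace T" for m n x
      using near[OF that(1,3)] near[OF that(2,3)] unfolding dist_real_def by linarith
    then show ?thesis
      by blast
  qed
  have cont: "continuous_map T euclideanreal (g k)" for k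
    using P[of k] unfolding P_def by (blast intro: continuous_map_into_fulltopology)
  have complete: "Met_TC.mcomplete TYPE(real)"
    by (simp add: complete_UNIV)
  obtain h where h: "continuous_map T euclideanreal h"
    "\<And>e. 0 < e \<Longrightarrow> \<forall>\<^sub>F n in sequentially. \<forall>x\<in>topspace T. dist (g n x) (h x) < e"
    using Met_TC.continuous_map_uniformly_Cauchy_limit[OF complete, of T g] cont cauchy by auto
  have lim: "(\<lambda>n. g n x) \<longlonglongrightarrow> h x" if "x \<in> topspace T" for x
  proof (rule tendstoI)
    fix e :: real assume "e > 0"
    show "\<forall>\<^sub>F n in sequentially. dist (g n x) (h x) < e"
      using h(2)[OF \<open>e > 0\<close>] by eventually_elim (use that in blast)
  qed
  have "g n x \<in> {0..1}" if "x \<in> topspace T" for n x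
    using P[of n] that unfolding P_def continuous_map_upper_lower_semicontinuous_le_gen by blast
  then have "h x \<in> {0..1}" if "x \<in> topspace T" for x
    using closed_sequentially[OF closed_real_atLeastAtMost _ lim[OF that]] that by blast
  then have "continuous_map T (top_of_set {0..1}) h"
    using h(1) by (auto simp: continuous_map_in_subtopology)
  moreover have "lipschitz_fun_on c' d (topspace T) (g n)" for n
    using P[of n] lipschitz_fun_on_mono[OF _ b(4)] unfolding P_def by blast
  then have "lipschitz_fun_on c' d (topspace T) h"
    by (rule lipschitz_fun_on_LIMSEQ[OF _ lim])
  moreover have "h y = f y" if "y \<in> Y" for y
  proof (rule LIMSEQ_unique)
    show "(\<lambda>n. g n y) \<longlonglongrightarrow> h y"
      using lim that YT by blast
    have "norm (g n y - f y) \<le> (1/2) ^ n" for n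
      using P[of n] that by (simp add: P_def)
    then have "(\<lambda>n. g n y - f y) \<longlonglongrightarrow> 0"
      by (intro Lim_null_comparison[OF _ LIMSEQ_power_zero[of "1/2"]]) auto
    then show "(\<lambda>n. g n y) \<longlonglongrightarrow> f y"
      by (rule LIM_zero_cancel)
  qed
  ultimately show thesis
    using that by blast
qed

section \<open>Separating functions and normality\<close>

text \<open>Lower semicontinuity makes the set where \<open>d\<close> is positive open, and this set
  is the complement of the diagonal. The purpose is to have closed points.\<close>

lemma topometric_space_Hausdorff:
  assumes "topometric_space T d"
  shows "Hausdorff_space T"
proof -
  have ext: "ext_metric_on (topspace T) d"
    and lsc: "lower_semicontinuous_map (prod_topology T T) (\<lambda>(x, y). d x y)"
    using assms by (simp_all add: topometric_space_def)
  have "topspace T \<times> topspace T - (\<lambda>x. (x, x)) ` topspace T =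
      {p \<in> topspace (prod_topology T T). 0 < (case p of (x, y) \<Rightarrow> d x y)}"
    using ext by (auto simp: ext_metric_on_def zero_less_iff_neq_zero)
  moreover have "openin (prod_topology T T) \<dots>"
    using lsc unfolding lower_semicontinuous_map_def by blast
  ultimately show ?thesis
    unfolding Hausdorff_space_closedin_diagonal closedin_def by auto
qed

text \<open>Cutting a separating function at half its height gives disjoint open sets. For the
  closed balls, a function separating \<open>F\<close> from a point outside the ball yields a
  neighbourhood of that point outside the ball, since a 1-Lipschitz function vanishing on
  \<open>F\<close> bounds the distance to \<open>F\<close> from below.\<close>

lemma normal_topometric_space_if_urysohn:
  assumes topometric: "topometric_space T d"
    and urysohn: "\<And>F G r. \<lbrakk>closedin T F; closedin T G; 0 < r; ennreal r < set_dist d F G\<rbrakk> \<Longrightarrow>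
      \<exists>h. continuous_map T (top_of_set {0..r}) h \<and> lipschitz_fun_on 1 d (topspace T) h \<and>
        (\<forall>x\<in>F. h x = 0) \<and> (\<forall>x\<in>G. h x = r)"
  shows "normal_topometric_space T d"
proof -
  have ext: "ext_metric_on (topspace T) d"
    using topometric by (simp add: topometric_space_def)
  have level: "openin T {x \<in> topspace T. h x < t}" "openin T {x \<in> topspace T. t < h x}"
    if "continuous_map T (top_of_set {0..r}) h" for h :: "'a \<Rightarrow> real" and r t
    using that unfolding continuous_map_upper_lower_semicontinuous_lt_gen by blast+
  have "\<exists>U V. openin T U \<and> openin T V \<and> F \<subseteq> U \<and> G \<subseteq> V \<and> disjnt U V"
    if FG: "closedin T F" "closedin T G" "set_dist d F G > 0" for F G
  proof -
    obtain r where r: "r > 0" "ennreal r < set_dist d F G"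
    proof -
      obtain e where e: "0 < e" "e < set_dist d F G"
        using dense[OF FG(3)] by blast
      then have "e < top"
        by (meson less_le_trans top_greatest)
      with e show thesis
        using that[of "enn2real e"] by (simp add: enn2real_positive_iff)
    qed
    obtain h where h: "continuous_map T (top_of_set {0..r}) h" "\<forall>x\<in>F. h x = 0" "\<forall>x\<in>G. h x = r"
      using urysohn[OF FG(1,2) r] by blast
    define U where "U = {x \<in> topspace T. h x < r / 2}"
    define V where "V = {x \<in> topspace T. r / 2 < h x}"
    have "openin T U" "openin T V"
      unfolding U_def V_def by (rule level[OF h(1)])+
    moreover have "F \<subseteq> U" "G \<subseteq> V"
      using h(2,3) r(1) closedin_subset[OF FG(1)] closedin_subset[OF FG(2)] by (auto simp: U_def V_def)
    moreover have "disjnt U V"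
      by (auto simp: disjnt_iff U_def V_def)
    ultimately show ?thesis
      by (intro exI[of _ U] exI[of _ V] conjI)
  qed
  moreover have "closedin T {x \<in> topspace T. pt_dist d x F \<le> ennreal r}"
    if F: "closedin T F" and "r > 0" for F and r :: real
  proof -
    have FT: "F \<subseteq> topspace T"
      using F by (rule closedin_subset)
    have "\<exists>U. openin T U \<and> x \<in> U \<and> U \<subseteq> {x \<in> topspace T. ennreal r < pt_dist d x F}"
      if x: "x \<in> topspace T" "ennreal r < pt_dist d x F" for x
    proof -
      have "pt_dist d x F = set_dist d {x} F"
        unfolding pt_dist_def set_dist_def by (rule INF_eq) auto
      then obtain s where s: "r < s" "\<forall>a\<in>F. ennreal s \<le> d x a"
        using x(2) less_set_dist_iff[of r d "{x}" F] \<open>r > 0\<close> by auto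
      then have "\<forall>a\<in>F. ennreal s \<le> d a x"
        using ext_metric_on_commute[OF ext x(1)] FT by fastforce
      \<comment> \<open>A value strictly below the distance is required; the midpoint is one and
        still exceeds \<open>r\<close>.\<close>
      then have "ennreal ((r + s) / 2) < set_dist d F {x}"
        using s(1) \<open>r > 0\<close> less_set_dist_iff[of "(r + s) / 2" d F "{x}"] by (force intro: exI[of _ s])
      moreover have "closedin T {x}"
        using topometric_space_Hausdorff[OF topometric] x(1) by (rule closedin_Hausdorff_singleton)
      moreover have "0 < (r + s) / 2"
        using s(1) \<open>r > 0\<close> by simp
      ultimately obtain h where h: "continuous_map T (top_of_set {0..(r + s) / 2}) h"
        "lipschitz_fun_on 1 d (topspace T) h" "\<forall>a\<in>F. h a = 0" "h x = (r + s) / 2"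
        using urysohn[OF F, of "{x}" "(r + s) / 2"] by blast
      \<comment> \<open>Midway between \<open>r\<close> and \<open>h x\<close>: the set where
        \<open>h\<close> exceeds \<open>?t\<close> contains \<open>x\<close>, and its points have
        distance at least \<open>?t\<close> from \<open>F\<close>.\<close>
      let ?t = "(3 * r + s) / 4"
      have "ennreal r < pt_dist d y F" if y: "y \<in> topspace T" "?t < h y" for y
      proof -
        have "ennreal ?t \<le> d y a" if "a \<in> F" for a
        proof -
          have "ennreal ?t \<le> ennreal \<bar>h y - h a\<bar>"
            using y(2) h(3) \<open>a \<in> F\<close> by (intro ennreal_leI) auto
          also have "\<dots> \<le> ennreal 1 * d y a"
            using h(2) y(1) \<open>a \<in> F\<close> FT unfolding lipschitz_fun_on_def by blast
          finally show ?thesis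
            by simp
        qed
        then have "ennreal ?t \<le> pt_dist d y F"
          unfolding pt_dist_def by (rule INF_greatest)
        moreover have "ennreal r < ennreal ?t"
          using s(1) \<open>r > 0\<close> by (simp add: ennreal_less_iff)
        ultimately show ?thesis
          by (rule less_le_trans[rotated])
      qed
      moreover have "?t < h x"
        using h(4) s(1) by simp
      ultimately show ?thesis
        using level(2)[OF h(1), of ?t] x(1) by blast
    qed
    then have "openin T {x \<in> topspace T. ennreal r < pt_dist d x F}"
      by (subst openin_subopen) blast
    moreover have "topspace T - {x \<in> topspace T. pt_dist d x F \<le> ennreal r} =
        {x \<in> topspace T. ennreal r < pt_dist d x F}"
      by auto
    ultimately show ?thesis
      unfolding closedin_def by auto
  qed
  ultimately show ?thesis
    unfolding normal_topometric_space_def using topometric by blast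
qed

text \<open>The function that is 0 on \<open>F\<close> and 1 on \<open>G\<close> is
  \<open>1 / s\<close>-Lipschitz for some \<open>s > r\<close>. The loss in the constant is absorbed
  by the gap between \<open>s\<close> and \<open>r\<close>: the extension is
  \<open>1 / r\<close>-Lipschitz, and multiplying it by \<open>r\<close> gives constant 1.\<close>

lemma urysohn_if_lipschitz_extension:
  assumes ext: "ext_metric_on (topspace T) d"
    and extension: "\<And>c c' Y f. \<lbrakk>0 \<le> c; c < c'; closedin T Y;
        continuous_map (subtopology T Y) (top_of_set {0..1}) f; lipschitz_fun_on c d Y f\<rbrakk> \<Longrightarrow>
      \<exists>g. continuous_map T (top_of_set {0..1}) g \<and> lipschitz_fun_on c' d (topspace T) g \<and>
        (\<forall>y\<in>Y. g y = f y)"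
    and FG: "closedin T F" "closedin T G" and r: "0 < r" "ennreal r < set_dist d F G"
  shows "\<exists>h. continuous_map T (top_of_set {0..r}) h \<and> lipschitz_fun_on 1 d (topspace T) h \<and>
      (\<forall>x\<in>F. h x = 0) \<and> (\<forall>x\<in>G. h x = r)"
proof -
  have sub: "F \<subseteq> topspace T" "G \<subseteq> topspace T"
    using FG by (auto dest: closedin_subset)
  obtain s where s: "s > r" "\<forall>a\<in>F. \<forall>b\<in>G. ennreal s \<le> d a b"
    using r less_set_dist_iff[of r d F G] by auto
  define f where "f = (\<lambda>x. if x \<in> F then 0 else 1 :: real)"
  have "F \<inter> G = {}"
  proof (rule ccontr)
    assume "F \<inter> G \<noteq> {}"
    then obtain x where "x \<in> F" "x \<in> G"
      by blast
    moreover from this have "x \<in> topspace T"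
      using sub by blast
    then have "d x x = 0"
      using ext by (simp add: ext_metric_on_def)
    ultimately have "ennreal s \<le> 0"
      using s(2) by metis
    then show False
      using s(1) r(1) by simp
  qed
  then have fG: "f x = 1" if "x \<in> G" for x
    using that by (auto simp: f_def)
  have fF: "f x = 0" if "x \<in> F" for x
    using that by (simp add: f_def)
  have Y: "closedin T (F \<union> G)"
    using FG by (rule closedin_Un)
  have top: "topspace (subtopology T (F \<union> G)) = F \<union> G"
    using sub by (intro topspace_subtopology_subset) simp
  \<comment> \<open>As \<open>f\<close> takes only two values, these four sets are all its sublevel
    and superlevel sets.\<close>
  have cl: "closedin (subtopology T (F \<union> G)) A" if "A \<in> {F \<union> G, F, G, {}}" for A
    using FG Y that by (auto intro: closedin_subset_topspace)
  have "{x \<in> F \<union> G. f x \<ge> t} \<in> {F \<union> G, F, G, {}}" "{x \<in> F \<union> G. f x \<le> t} \<in> {F \<union> G, F, G, {}}" for t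
  proof -
    have "{x \<in> F \<union> G. f x \<ge> t} = (if t \<le> 0 then F \<union> G else if t \<le> 1 then G else {})"
      by (auto simp: fF fG)
    then show "{x \<in> F \<union> G. f x \<ge> t} \<in> {F \<union> G, F, G, {}}"
      by auto
    have "{x \<in> F \<union> G. f x \<le> t} = (if t < 0 then {} else if t < 1 then F else F \<union> G)"
      by (auto simp: fF fG)
    then show "{x \<in> F \<union> G. f x \<le> t} \<in> {F \<union> G, F, G, {}}"
      by auto
  qed
  then have "continuous_map (subtopology T (F \<union> G)) (top_of_set {0..1}) f"
    unfolding continuous_map_upper_lower_semicontinuous_le_gen top
    using cl by (auto simp: f_def)
  moreover have "s > 0"
    using s(1) r(1) by linarith
  have "ennreal s \<le> d x y" if "x \<in> F \<and> y \<in> G \<or> x \<in> G \<and> y \<in> F" for x y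
    using that s(2) ext_metric_on_commute[OF ext, of x y] sub by fastforce
  then have "ennreal (\<bar>f x - f y\<bar> / (1 / s)) \<le> d x y" if "x \<in> F \<union> G" "y \<in> F \<union> G" for x y
    using that fF fG by auto
  then have "lipschitz_fun_on (1 / s) d (F \<union> G) f"
    using \<open>s > 0\<close> by (subst lipschitz_fun_on_iff) auto
  moreover have "0 \<le> 1 / s" "1 / s < 1 / r"
    using s(1) r(1) by (simp_all add: field_simps)
  ultimately obtain g where g: "continuous_map T (top_of_set {0..1}) g"
    "lipschitz_fun_on (1 / r) d (topspace T) g" "\<forall>y\<in>F \<union> G. g y = f y"
    using extension[OF _ _ Y, of "1 / s" "1 / r" f] by blast
  have "continuous_map T euclideanreal (\<lambda>x. r * g x)"
    using g(1) by (intro continuous_map_real_mult_left) (auto intro: continuous_map_into_fulltopology)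
  moreover have "r * g x \<in> {0..r}" if "x \<in> topspace T" for x
    using g(1) that r(1) unfolding continuous_map_upper_lower_semicontinuous_le_gen
    by (auto simp: mult_left_le)
  ultimately have "continuous_map T (top_of_set {0..r}) (\<lambda>x. r * g x)"
    by (auto simp: continuous_map_in_subtopology)
  moreover have "\<bar>r * g x - r * g y\<bar> / 1 = \<bar>g x - g y\<bar> / (1 / r)" for x y
    using r(1) by (simp add: abs_mult flip: right_diff_distrib)
  then have "lipschitz_fun_on 1 d (topspace T) (\<lambda>x. r * g x)"
    using g(2) r(1) by (simp add: lipschitz_fun_on_iff del: div_by_1)
  moreover have "\<forall>x\<in>F. r * g x = 0" "\<forall>x\<in>G. r * g x = r"
    using g(3) fF fG by auto
  ultimately show ?thesis
    by blast
qed

text \<open>Two levels suffice. Taking the whole space as upper set at level 0 and as lower set at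
  level \<open>r\<close> makes the approximation total and leaves \<open>F\<close> and
  \<open>G\<close> as the only pair to compare.\<close>

lemma urysohn_if_finite_lipschitz_approximation:
  assumes approx: "\<And>S F G. \<lbrakk>finite S; lipschitz_approximation T d 1 S F G\<rbrakk> \<Longrightarrow>
      \<exists>h. continuous_map T euclideanreal h \<and> lipschitz_fun_on 1 d (topspace T) h \<and>
        approximates S F G h"
    and FG: "closedin T F" "closedin T G" and r: "0 < r" "ennreal r < set_dist d F G"
  shows "\<exists>h. continuous_map T (top_of_set {0..r}) h \<and> lipschitz_fun_on 1 d (topspace T) h \<and>
      (\<forall>x\<in>F. h x = 0) \<and> (\<forall>x\<in>G. h x = r)"
proof -
  have sub: "F \<subseteq> topspace T" "G \<subseteq> topspace T"
    using FG by (auto dest: closedin_subset)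
  define A where "A = (\<lambda>\<alpha>::real. if \<alpha> = 0 then F else topspace T)"
  define B where "B = (\<lambda>\<alpha>::real. if \<alpha> = 0 then topspace T else G)"
  have "lipschitz_approximation T d 1 {0, r} A B"
    unfolding lipschitz_approximation_def partial_lipschitz_approximation_def
    using FG sub r by (auto simp: A_def B_def)
  then obtain h where h: "continuous_map T euclideanreal h" "lipschitz_fun_on 1 d (topspace T) h"
    "approximates {0, r} A B h"
    using approx[of "{0, r}" A B] by blast
  \<comment> \<open>Truncation does not increase differences, so the constant 1 survives.\<close>
  let ?h = "\<lambda>x. max 0 (min r (h x))"
  have "continuous_map T euclideanreal ?h"
    using h(1) by (intro continuous_map_real_max continuous_map_real_min) auto
  then have "continuous_map T (top_of_set {0..r}) ?h"
    using r(1) by (auto simp: continuous_map_in_subtopology)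
  moreover have "lipschitz_fun_on 1 d (topspace T) ?h"
    unfolding lipschitz_fun_on_def
  proof (intro ballI)
    fix x y assume xy: "x \<in> topspace T" "y \<in> topspace T"
    have "ennreal \<bar>?h x - ?h y\<bar> \<le> ennreal \<bar>h x - h y\<bar>"
      by (intro ennreal_leI) linarith
    also have "\<dots> \<le> ennreal 1 * d x y"
      using h(2) xy unfolding lipschitz_fun_on_def by blast
    finally show "ennreal \<bar>?h x - ?h y\<bar> \<le> ennreal 1 * d x y" .
  qed
  moreover have "\<forall>x\<in>F. ?h x = 0" "\<forall>x\<in>G. ?h x = r"
    using h(3) r(1) by (auto simp: approximates_def A_def B_def)
  ultimately show ?thesis
    by blast
qed

lemma normal_finite_lipschitz_approximation_approximates:
  assumes normal: "normal_topometric_space T d" and "c > 0" "finite S"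
    and approx: "lipschitz_approximation T d c S F G"
  shows "\<exists>h. continuous_map T euclideanreal h \<and> lipschitz_fun_on c d (topspace T) h \<and>
      approximates S F G h"
proof -
  obtain m M where "S \<subseteq> {m..M}" "m < M"
  proof
    \<comment> \<open>Inserting 0 covers empty \<open>S\<close>; adding 1 makes the interval
      nondegenerate.\<close>
    show "S \<subseteq> {Min (insert 0 S)..Max (insert 0 S) + 1}"
      using \<open>finite S\<close> by (auto simp: add_increasing2)
    have "Min (insert 0 S) \<le> 0" "0 \<le> Max (insert 0 S)"
      using \<open>finite S\<close> by simp_all
    then show "Min (insert 0 S) < Max (insert 0 S) + 1"
      by linarith
  qed
  moreover have "partial_lipschitz_approximation T d c S F G"
    using approx by (simp add: lipschitz_approximation_def)
  ultimately obtain h where "continuous_map T (top_of_set {m..M}) h"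
    "lipschitz_fun_on c d (topspace T) h" "approximates S F G h"
    using normal_partial_lipschitz_approximation_approximates[OF normal \<open>c > 0\<close> \<open>finite S\<close>] by blast
  then show ?thesis
    by (blast intro: continuous_map_into_fulltopology)
qed

theorem theorem1p9:
  fixes T :: "'a topology" and d :: "'a \<Rightarrow> 'a \<Rightarrow> ennreal"
  assumes "topometric_space T d"
  shows
    "(normal_topometric_space T d \<longrightarrow>
       (\<forall>c c' :: real. 0 \<le> c \<and> c < c' \<longrightarrow>
         (\<forall>Y f. closedin T Y \<and>
                continuous_map (subtopology T Y) (top_of_set {0..1}) f \<and>
                lipschitz_fun_on c d Y f \<longrightarrow>
           (\<exists>g. continuous_map T (top_of_set {0..1}) g \<and>
                lipschitz_fun_on c' d (topspace T) g \<and>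
                (\<forall>y\<in>Y. g y = f y))))) \<and>
     (normal_topometric_space T d \<longleftrightarrow>
       (\<forall>c c' :: real. 0 \<le> c \<and> c < c' \<longrightarrow>
         (\<forall>Y f. closedin T Y \<and>
                continuous_map (subtopology T Y) (top_of_set {0..1}) f \<and>
                lipschitz_fun_on c d Y f \<longrightarrow>
           (\<exists>g. continuous_map T (top_of_set {0..1}) g \<and>
                lipschitz_fun_on c' d (topspace T) g \<and>
                (\<forall>y\<in>Y. g y = f y))))) \<and>
     (normal_topometric_space T d \<longleftrightarrow>
       (\<forall>c::real. c > 0 \<longrightarrow>
         (\<forall>S F G. finite S \<and> lipschitz_approximation T d c S F G \<longrightarrow>
           (\<exists>h. continuous_map T euclideanreal h \<and>
                lipschitz_fun_on c d (topspace T) h \<and>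
                approximates S F G h)))) \<and>
     (normal_topometric_space T d \<longleftrightarrow>
       (\<forall>F G. closedin T F \<and> closedin T G \<longrightarrow>
         (\<forall>r::real. 0 < r \<and> ennreal r < set_dist d F G \<longrightarrow>
           (\<exists>h. continuous_map T (top_of_set {0..r}) h \<and>
                lipschitz_fun_on 1 d (topspace T) h \<and>
                (\<forall>x\<in>F. h x = 0) \<and> (\<forall>x\<in>G. h x = r)))))"
proof -
  have ext: "ext_metric_on (topspace T) d"
    using assms by (simp add: topometric_space_def)
  let ?ext = "\<forall>c c' :: real. 0 \<le> c \<and> c < c' \<longrightarrow>
    (\<forall>Y f. closedin T Y \<and> continuous_map (subtopology T Y) (top_of_set {0..1}) f \<and>
        lipschitz_fun_on c d Y f \<longrightarrow>
      (\<exists>g. continuous_map T (top_of_set {0..1}) g \<and> lipschitz_fun_on c' d (topspace T) g \<and>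
        (\<forall>y\<in>Y. g y = f y)))"
  let ?approx = "\<forall>c::real. c > 0 \<longrightarrow>
    (\<forall>S F G. finite S \<and> lipschitz_approximation T d c S F G \<longrightarrow>
      (\<exists>h. continuous_map T euclideanreal h \<and> lipschitz_fun_on c d (topspace T) h \<and>
        approximates S F G h))"
  let ?urysohn = "\<forall>F G. closedin T F \<and> closedin T G \<longrightarrow>
    (\<forall>r::real. 0 < r \<and> ennreal r < set_dist d F G \<longrightarrow>
      (\<exists>h. continuous_map T (top_of_set {0..r}) h \<and> lipschitz_fun_on 1 d (topspace T) h \<and>
        (\<forall>x\<in>F. h x = 0) \<and> (\<forall>x\<in>G. h x = r)))"
  \<comment> \<open>The equivalences follow from two cycles: (i), (ii), (iv), (i) and (i), (iii),
    (iv), (i).\<close>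
  have i_ii: ?ext if "normal_topometric_space T d"
  proof (intro allI impI; elim conjE)
    fix c c' :: real and Y f
    assume "0 \<le> c" "c < c'" "closedin T Y" "lipschitz_fun_on c d Y f"
      "continuous_map (subtopology T Y) (top_of_set {0..1}) f"
    then show "\<exists>g. continuous_map T (top_of_set {0..1}) g \<and> lipschitz_fun_on c' d (topspace T) g \<and>
        (\<forall>y\<in>Y. g y = f y)"
      using normal_lipschitz_extension[OF that, of c c' Y f] by metis
  qed
  have ii_iv: ?urysohn if ?ext
    by (intro allI impI urysohn_if_lipschitz_extension[OF ext]) (use that in simp_all)
  have i_iii: ?approx if "normal_topometric_space T d"
    by (intro allI impI normal_finite_lipschitz_approximation_approximates[OF that]) simp_all
  have iii_iv: ?urysohn if ?approx
    by (intro allI impI urysohn_if_finite_lipschitz_approximation) (use that in simp_all)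
  have iv_i: "normal_topometric_space T d" if ?urysohn
    by (rule normal_topometric_space_if_urysohn[OF assms]) (use that in simp)
  have "normal_topometric_space T d \<longleftrightarrow> ?ext"
    using i_ii iv_i[OF ii_iv] by (rule iffI)
  moreover have "normal_topometric_space T d \<longleftrightarrow> ?approx"
    using i_iii iv_i[OF iii_iv] by (rule iffI)
  moreover have "normal_topometric_space T d \<longleftrightarrow> ?urysohn"
    using iii_iv[OF i_iii] iv_i by (rule iffI)
  ultimately show ?thesis
    using i_ii by (intro conjI impI)
qed

end
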